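(* Every split graph is spectrally threshold dominated.
   Context: All graphs are finite and simple. A split graph is a graph whose node set can be partitioned into two sets $A$ and $B$ such that $A$ induces a clique and $B$ induces no edge. For a graph $G$ on $n$ nodes, the Laplacian eigenvalues (eigenvalues of $L(G)=D(G)-A(G)$) are $\lambda_1(G)\ge\dots\ge\lambda_n(G)=0$. A threshold graph is a graph obtainable from the empty graph by repeatedly adding a new node that is either isolated or adjacent to all previously added nodes. A graph $G$ on $n$ nodes with $m$ edges is spectrally threshold dominated if for each $k\in\{1,\dots,n\}$ there is a threshold graph $T_k$ on $n$ nodes with $m$ edges satisfying $\sum_{i=1}^k\lambda_i(T_k)\ge\sum_{i=1}^k\lambda_i(G)$. *)

theory Defs
  imports "Jordan_Normal_Form.Char_Poly"
begin

definition simple_graph :: "'a set \<Rightarrow> 'a set set \<Rightarrow> bool" where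
  "simple_graph V E \<longleftrightarrow> finite V \<and> E \<subseteq> {{u, v} | u v. u \<in> V \<and> v \<in> V \<and> u \<noteq> v}"

definition split_graph :: "'a set \<Rightarrow> 'a set set \<Rightarrow> bool" where
  "split_graph V E \<longleftrightarrow> (\<exists>A B. A \<union> B = V \<and> A \<inter> B = {} \<and>
      (\<forall>u\<in>A. \<forall>v\<in>A. u \<noteq> v \<longrightarrow> {u, v} \<in> E) \<and>
      (\<forall>u\<in>B. \<forall>v\<in>B. {u, v} \<notin> E))"

inductive threshold_graph :: "'a set \<Rightarrow> 'a set set \<Rightarrow> bool" where
  empty: "threshold_graph {} {}"
| add_isolated: "threshold_graph V E \<Longrightarrow> v \<notin> V \<Longrightarrow> threshold_graph (insert v V) E"
| add_dominating: "threshold_graph V E \<Longrightarrow> v \<notin> V \<Longrightarrow>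
     threshold_graph (insert v V) (E \<union> {{u, v} | u. u \<in> V})"

definition degree :: "'a set set \<Rightarrow> 'a \<Rightarrow> nat" where
  "degree E i = card {e \<in> E. i \<in> e}"

definition laplacian :: "nat \<Rightarrow> nat set set \<Rightarrow> real mat" where
  "laplacian n E = mat n n (\<lambda>(i, j). if i = j then real (degree E i)
                                      else if {i, j} \<in> E then -1 else 0)"

(* Laplacian eigenvalues lambda_1 >= ... >= lambda_n, listed with multiplicity:
   the (unique) non-increasing list of reals whose linear factors multiply to the
   characteristic polynomial of the Laplacian (which splits over R, as L is symmetric). *)
definition lap_eigs :: "nat \<Rightarrow> nat set set \<Rightarrow> real list" where
  "lap_eigs n E = (THE ls. length ls = n \<and> sorted_wrt (\<ge>) ls \<and>
       char_poly (laplacian n E) = prod_list (map (\<lambda>l. [:- l, 1:]) ls))"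

definition lap_eig_sum :: "nat \<Rightarrow> nat set set \<Rightarrow> nat \<Rightarrow> real" where
  "lap_eig_sum n E k = sum_list (take k (lap_eigs n E))"

definition spectrally_threshold_dominated :: "nat \<Rightarrow> nat set set \<Rightarrow> bool" where
  "spectrally_threshold_dominated n E \<longleftrightarrow>
     (\<forall>k\<in>{1..n}. \<exists>T. threshold_graph {0..<n} T \<and> card T = card E \<and>
          lap_eig_sum n T k \<ge> lap_eig_sum n E k)"

end

theory Submission
  imports Defs "Jordan_Normal_Form.Schur_Decomposition"
begin

text \<open>
  Let $m$ be the number of edges. For $S \subseteq \{1,\dots,n-1\}$ let the threshold graph $T_S$ have the
  edges $\{i,j\}$ with $i < j \in S$; it has $\sum S$ edges and an explicit eigenbasis. Choosing $S$ suitably,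
  its $k$ largest eigenvalues sum up to at least $\min(2m,\ kn,\ m + k(k+1)/2)$. The sum for any graph is at
  most $2m$ (trace) and $kn$, so it remains to show Brouwer's inequality
  $\sum_{i \le k} \lambda_i \le m + k(k+1)/2$ for split graphs.

  Let the clique $A$ have $a$ vertices, let $N$ be the $A \times B$ biadjacency matrix, and let $e$ be the number
  of edges between $A$ and $B$. It suffices that $\sum_i \max(0, \lambda_i - a) \le e$, because then
  $\sum_{i \le k} \lambda_i \le ak + e = m + ak - a(a-1)/2 \le m + k(k+1)/2$.
  The matrix $M = L + 1_A 1^T$ has the eigenvalues of $L$ with one $0$ replaced by $a$. The Riccati equation
  $(D_A + a) Z = (J - N) + Z (N^T Z + D_B)$ has a minimal nonnegative solution $Z$, with column sums at most $1$,
  and it makes $M$ similar to a block triangular matrix with diagonal blocks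
  $Q = D_A + a - Z N^T$ and $R = D_B + N^T Z$. As in the theory of M-matrices, the eigenvalues of $Q$
  are at least $a$ and those of $R$ are at most $a$; so the sum in question is
  $\mathrm{tr}(Q) - a^2 = e - \mathrm{tr}(Z N^T) \le e$.
\<close>

section \<open>Polynomials with linear factors and characteristic polynomials\<close>

abbreviation lin_prod :: "'a :: comm_ring_1 list \<Rightarrow> 'a poly" where
  "lin_prod ls \<equiv> prod_list (map (\<lambda>l. [:- l, 1:]) ls)"

lemma poly_lin_prod_eq_0_iff: "poly (lin_prod (ls :: 'a :: idom list)) x = 0 \<longleftrightarrow> x \<in> set ls"
  by (induction ls) auto

lemma lin_prod_mset_cong: "mset xs = mset ys \<Longrightarrow> lin_prod (xs :: 'a :: idom list) = lin_prod ys"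
  by (metis mset_map prod_mset_prod_list)

text \<open>Unique factorization for linear factors: a root of one side is a root of the other, and
  its factor cancels in an integral domain.\<close>

lemma mset_eq_if_lin_prod_eq:
  "lin_prod (xs :: 'a :: idom list) = lin_prod ys \<Longrightarrow> mset xs = mset ys"
proof (induction xs arbitrary: ys)
  case Nil
  then show ?case using poly_lin_prod_eq_0_iff[of ys] by (cases ys) auto
next
  case (Cons x xs)
  have "x \<in> set ys"
    using poly_lin_prod_eq_0_iff[of ys x] Cons.prems[symmetric] by simp
  then have ys: "mset ys = mset (x # remove1 x ys)" by simp
  then have "lin_prod ys = lin_prod (x # remove1 x ys)" by (rule lin_prod_mset_cong)
  then have "[:- x, 1:] * lin_prod xs = [:- x, 1:] * lin_prod (remove1 x ys)" using Cons.prems by simp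
  then have "lin_prod xs = lin_prod (remove1 x ys)" by (subst (asm) mult_cancel_left) auto
  from Cons.IH[OF this] have "mset (x # xs) = mset (x # remove1 x ys)" by (simp only: mset.simps)
  then show ?case unfolding ys[symmetric] .
qed

text \<open>Serves to split the characteristic polynomials of the blocks \<open>Qmat\<close> and
  \<open>Rmat\<close> over the reals: these blocks need not be symmetric, but their polynomials
  divide one that splits.\<close>

lemma dvd_lin_prod_imp_lin_prod:
  fixes p :: "'a :: field poly"
  assumes "lead_coeff p = 1" "p dvd lin_prod ls"
  shows "\<exists>ms. p = lin_prod ms"
  using assms
proof (induction ls arbitrary: p)
  case Nil
  then have "p dvd 1" by simp
  then have "Polynomial.degree p = 0" by (simp add: poly_dvd_1)
  then have "p = 1" using Nil.prems(1) by (metis degree_0_id one_pCons)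
  then show ?case by (intro exI[of _ "[]"]) simp
next
  case (Cons l ls)
  show ?case
  proof (cases "poly p l = 0")
    case True
    then obtain p' where p': "p = [:- l, 1:] * p'" by (auto simp: poly_eq_0_iff_dvd)
    have "lead_coeff p' = 1" using Cons.prems(1) unfolding p' lead_coeff_mult by simp
    moreover have "p' dvd lin_prod ls"
    proof -
      have "[:- l, 1:] * p' dvd [:- l, 1:] * lin_prod ls" using Cons.prems(2) p' by simp
      then show ?thesis by (subst (asm) dvd_mult_cancel_left) auto
    qed
    ultimately obtain ms where "p' = lin_prod ms" using Cons.IH by blast
    then show ?thesis by (intro exI[of _ "l # ms"]) (simp add: p')
  next
    case False
    obtain q where q: "[:- l, 1:] * lin_prod ls = p * q" using Cons.prems(2) unfolding dvd_def
      by (auto simp only: list.map prod_list.Cons)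
    \<comment> \<open>As \<open>l\<close> is no root of \<open>p\<close>, its factor sits in the
      cofactor \<open>q\<close> and can be cancelled there.\<close>
    have "poly (p * q) l = 0" unfolding q[symmetric] by simp
    then have "poly q l = 0" using False by simp
    then obtain q' where q': "q = [:- l, 1:] * q'" by (auto simp: poly_eq_0_iff_dvd)
    have "[:- l, 1:] * lin_prod ls = [:- l, 1:] * (p * q')" using q q' by (simp only: mult_ac)
    then have "lin_prod ls = p * q'" by (subst (asm) mult_cancel_left) auto
    then have "p dvd lin_prod ls" by simp
    then show ?thesis using Cons.IH Cons.prems(1) by blast
  qed
qed

section \<open>Characteristic polynomials under block, similarity and rank-one operations\<close>

lemma lead_coeff_char_poly: "A \<in> carrier_mat n n \<Longrightarrow> lead_coeff (char_poly A) = 1"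
  using degree_monic_char_poly[of A n] by simp

lemma char_poly_block_upper:
  fixes B :: "'a :: idom mat"
  assumes B: "B \<in> carrier_mat n n" and C: "C \<in> carrier_mat n m" and D: "D \<in> carrier_mat m m"
  shows "char_poly (four_block_mat B C (0\<^sub>m m n) D) = char_poly B * char_poly D"
proof -
  let ?cm = "\<lambda>A. [:0, 1:] \<cdot>\<^sub>m 1\<^sub>m (dim_row A) + map_mat (\<lambda>a. [:- a:]) A"
  let ?A = "four_block_mat B C (0\<^sub>m m n) D"
  have "char_poly ?A = det (?cm ?A)" unfolding char_poly_defs using B D by simp
  also have "?cm ?A = four_block_mat (?cm B) (map_mat (\<lambda>a. [:- a:]) C) (0\<^sub>m m n) (?cm D)"
    by (rule eq_matI, insert B C D, auto simp: one_poly_def)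
  also have "det \<dots> = det (?cm B) * det (?cm D)"
    by (rule det_four_block_mat_lower_left_zero[of _ n _ m], insert B C D, auto)
  finally show ?thesis unfolding char_poly_defs .
qed

lemma char_poly_block_lower:
  fixes B :: "'a :: idom mat"
  assumes B: "B \<in> carrier_mat n n" and C: "C \<in> carrier_mat m n" and D: "D \<in> carrier_mat m m"
  shows "char_poly (four_block_mat B (0\<^sub>m n m) C D) = char_poly B * char_poly D"
proof -
  let ?A = "four_block_mat B (0\<^sub>m n m) C D"
  have A: "?A \<in> carrier_mat (n + m) (n + m)" using B D by auto
  have "char_poly ?A = char_poly (transpose_mat ?A)" using char_poly_transpose_mat[OF A] by simp
  also have "transpose_mat ?A = four_block_mat (transpose_mat B) (transpose_mat C) (0\<^sub>m m n) (transpose_mat D)"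
    using transpose_four_block_mat[OF B zero_carrier_mat C D] by simp
  also have "char_poly \<dots> = char_poly (transpose_mat B) * char_poly (transpose_mat D)"
    by (rule char_poly_block_upper) (use B C D in auto)
  finally show ?thesis using char_poly_transpose_mat[OF B] char_poly_transpose_mat[OF D] by simp
qed

text \<open>Similarity in the form \<open>A * P = P * B\<close>, so that an application compares two
  block products and never expands \<open>P * B * Q\<close>.\<close>

lemma char_poly_eq_if_intertwined:
  fixes A :: "'a :: comm_ring_1 mat"
  assumes A: "A \<in> carrier_mat n n" and B: "B \<in> carrier_mat n n"
    and P: "P \<in> carrier_mat n n" and Q: "Q \<in> carrier_mat n n"
    and inv: "P * Q = 1\<^sub>m n" "Q * P = 1\<^sub>m n" and AP: "A * P = P * B"
  shows "char_poly A = char_poly B"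
proof -
  have "P * B * Q = A * P * Q" using AP by simp
  also have "\<dots> = A" using A P Q inv by (simp add: assoc_mult_mat[of A n n P n Q n])
  finally show ?thesis
    using A B P Q inv by (intro char_poly_similar) (auto simp: similar_mat_def intro!: exI similar_mat_witI)
qed

lemma trace_mult_commute:
  fixes A B :: "'a :: comm_ring_1 mat"
  assumes "A \<in> carrier_mat n n" "B \<in> carrier_mat n n"
  shows "(\<Sum>i<n. (A * B) $$ (i, i)) = (\<Sum>i<n. (B * A) $$ (i, i))"
proof -
  have "(\<Sum>i<n. (A * B) $$ (i, i)) = (\<Sum>i<n. \<Sum>j<n. A $$ (i, j) * B $$ (j, i))"
    using assms by (intro sum.cong refl) (auto simp: scalar_prod_def lessThan_atLeast0)
  also have "\<dots> = (\<Sum>j<n. \<Sum>i<n. B $$ (j, i) * A $$ (i, j))"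
    by (subst sum.swap) (simp add: mult.commute)
  also have "\<dots> = (\<Sum>i<n. (B * A) $$ (i, i))"
    using assms by (intro sum.cong refl) (auto simp: scalar_prod_def lessThan_atLeast0)
  finally show ?thesis .
qed

text \<open>A Schur decomposition yields a similar matrix with diagonal \<open>ls\<close>, and the
  trace is invariant under similarity.\<close>

lemma sum_list_eq_trace:
  fixes A :: "real mat"
  assumes A: "A \<in> carrier_mat n n" and ls: "char_poly A = lin_prod ls"
  shows "sum_list ls = (\<Sum>i<n. A $$ (i, i))"
proof -
  obtain B P Q where "schur_decomposition A ls = (B, P, Q)" by (cases "schur_decomposition A ls") auto
  from schur_decomposition[OF A ls this]
  have sim: "similar_mat_wit A B P Q" and diag: "diag_mat B = ls" by auto
  note w = similar_mat_witD2[OF A sim]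
  have "(\<Sum>i<n. A $$ (i, i)) = (\<Sum>i<n. (P * (B * Q)) $$ (i, i))"
    unfolding w(3) using assoc_mult_mat[OF w(6) w(5) w(7)] by simp
  also have "\<dots> = (\<Sum>i<n. (B * Q * P) $$ (i, i))"
    using w by (intro trace_mult_commute) auto
  also have "B * Q * P = B" using w by (simp add: assoc_mult_mat[of B n n Q n P n])
  also have "(\<Sum>i<n. B $$ (i, i)) = sum_list (diag_mat B)"
    using w by (auto simp: diag_mat_def interv_sum_list_conv_sum_set_nat lessThan_atLeast0)
  finally show ?thesis using diag by simp
qed

lemma ex_coord_eigenvector:
  fixes A :: "'a :: field mat"
  assumes A: "A \<in> carrier_mat n n" and "poly (char_poly A) x = 0"
  obtains v where "\<exists>i<n. v i \<noteq> 0" "\<And>i. i < n \<Longrightarrow> (\<Sum>j<n. A $$ (i, j) * v j) = x * v i"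
proof -
  obtain v where v: "v \<in> carrier_vec n" "v \<noteq> 0\<^sub>v n" "A *\<^sub>v v = x \<cdot>\<^sub>v v"
    using assms eigenvalue_root_char_poly[OF A, of x] A by (auto simp: eigenvalue_def eigenvector_def)
  show thesis
  proof
    show "\<exists>i<n. v $ i \<noteq> 0" using v by (auto simp: vec_eq_iff)
    fix i assume i: "i < n"
    have "(A *\<^sub>v v) $ i = (\<Sum>j<n. A $$ (i, j) * v $ j)"
      using i v(1) A by (auto simp: scalar_prod_def lessThan_atLeast0)
    then show "(\<Sum>j<n. A $$ (i, j) * v $ j) = x * v $ i" using v i by simp
  qed
qed

text \<open>Over the complex numbers the polynomial splits. For a root \<open>z\<close> with
  eigenvector \<open>v\<close>, the quadratic form of \<open>A\<close> at \<open>v\<close> is real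
  and equals \<open>z\<close> times the squared norm of \<open>v\<close>, so \<open>z\<close> is
  real.\<close>

lemma symmetric_char_poly_splits:
  fixes A :: "real mat"
  assumes A: "A \<in> carrier_mat n n"
    and sym: "\<And>i j. i < n \<Longrightarrow> j < n \<Longrightarrow> A $$ (i, j) = A $$ (j, i)"
  obtains ls where "length ls = n" "char_poly A = lin_prod ls"
proof -
  let ?c = "map_mat complex_of_real A"
  have C: "?c \<in> carrier_mat n n" using A by simp
  have hom: "char_poly ?c = map_poly complex_of_real (char_poly A)"
    by (rule of_real_hom.char_poly_hom[OF A])
  obtain zs where zs: "char_poly ?c = lin_prod zs" "length zs = n"
    using char_poly_factorized[OF C] by blast
  have real: "z \<in> \<real>" if "z \<in> set zs" for z
  proof -
    have "poly (char_poly ?c) z = 0" using that by (simp add: zs poly_lin_prod_eq_0_iff)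
    then obtain v where v0: "\<exists>i<n. v i \<noteq> 0"
      and v: "\<And>i. i < n \<Longrightarrow> (\<Sum>j<n. ?c $$ (i, j) * v j) = z * v i"
      using ex_coord_eigenvector[OF C] by metis
    have v: "(\<Sum>j<n. of_real (A $$ (i, j)) * v j) = z * v i" if "i < n" for i
      using v[OF that] A that by simp
    define h where "h = (\<Sum>i<n. (cmod (v i))\<^sup>2)"
    have "0 < h"
    proof -
      obtain i where "i < n" "v i \<noteq> 0" using v0 by blast
      then show ?thesis unfolding h_def by (intro sum_pos2[of _ i]) auto
    qed
    have hz: "(\<Sum>i<n. cnj (v i) * (\<Sum>j<n. of_real (A $$ (i, j)) * v j)) = z * of_real h"
    proof -
      have "(\<Sum>i<n. cnj (v i) * (\<Sum>j<n. of_real (A $$ (i, j)) * v j)) = (\<Sum>i<n. z * (v i * cnj (v i)))"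
        using v by (intro sum.cong refl) (simp add: mult_ac)
      also have "\<dots> = z * of_real h"
        by (simp add: h_def sum_distrib_left complex_norm_square[symmetric])
      finally show ?thesis .
    qed
    \<comment> \<open>Conjugation followed by exchanging the two indices returns the original double
      sum, by symmetry of \<open>A\<close>.\<close>
    have "cnj (z * of_real h) = (\<Sum>i<n. \<Sum>j<n. v i * of_real (A $$ (i, j)) * cnj (v j))"
      unfolding hz[symmetric] by (simp add: sum_distrib_left mult_ac)
    also have "\<dots> = (\<Sum>j<n. \<Sum>i<n. v i * of_real (A $$ (j, i)) * cnj (v j))"
      by (subst sum.swap) (intro sum.cong refl, auto simp: sym)
    also have "\<dots> = z * of_real h"
      unfolding hz[symmetric] by (simp add: sum_distrib_left mult_ac)
    finally have "cnj z = z" using \<open>0 < h\<close> by simp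
    then show ?thesis by (simp add: complex_is_Real_iff complex_eq_iff)
  qed
  have "map_poly complex_of_real (char_poly A) = map_poly complex_of_real (lin_prod (map Re zs))"
  proof -
    have "lin_prod zs = map_poly complex_of_real (lin_prod (map Re zs))"
      using real
    proof (induction zs)
      case (Cons z zs)
      interpret h: map_poly_comm_ring_hom complex_of_real ..
      have "[:- z, 1:] = map_poly complex_of_real [:- Re z, 1:]" using Cons.prems[of z] by simp
      then have "[:- z, 1:] * lin_prod zs = map_poly complex_of_real ([:- Re z, 1:] * lin_prod (map Re zs))"
        unfolding h.hom_mult using Cons by simp
      then show ?case by (simp only: list.map prod_list.Cons)
    qed simp
    then show ?thesis using hom zs by simp
  qed
  then have "char_poly A = lin_prod (map Re zs)"
    by (simp add: poly_eq_iff coeff_map_poly)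
  then show thesis using that[of "map Re zs"] zs by simp
qed

text \<open>Conjugation by the permutation matrix of \<open>\<pi>\<close>; later it lists the clique
  vertices first.\<close>

lemma char_poly_reindex:
  fixes A :: "'a :: comm_ring_1 mat"
  assumes A: "A \<in> carrier_mat n n" and bij: "bij_betw \<pi> {..<n} {..<n}"
  shows "char_poly (mat n n (\<lambda>(i, j). A $$ (\<pi> i, \<pi> j))) = char_poly A"
proof -
  let ?B = "mat n n (\<lambda>(i, j). A $$ (\<pi> i, \<pi> j))"
  define P :: "'a mat" where "P = mat n n (\<lambda>(i, j). of_bool (i = \<pi> j))"
  have lt: "\<pi> i < n" if "i < n" for i using bij that by (auto simp: bij_betw_def)
  have inj: "\<pi> i = \<pi> j \<longleftrightarrow> i = j" if "i < n" "j < n" for i j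
    using bij that by (auto simp: bij_betw_def inj_on_def)
  have reindex: "(\<Sum>l<n. f (\<pi> l)) = (\<Sum>l<n. f l)" for f :: "nat \<Rightarrow> 'a"
    by (rule sum.reindex_bij_betw[OF bij])
  have "char_poly A = char_poly ?B"
  proof (rule char_poly_eq_if_intertwined[OF A])
    show "P * transpose_mat P = 1\<^sub>m n"
    proof (rule eq_matI)
      fix i j assume "i < dim_row (1\<^sub>m n :: 'a mat)" "j < dim_col (1\<^sub>m n :: 'a mat)"
      then have ij: "i < n" "j < n" by auto
      have "(P * transpose_mat P) $$ (i, j) = (\<Sum>l<n. of_bool (i = \<pi> l) * of_bool (j = \<pi> l))"
        using ij by (simp add: P_def scalar_prod_def lessThan_atLeast0)
      also have "\<dots> = (\<Sum>l<n. of_bool (i = l) * of_bool (j = l))" by (rule reindex)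
      also have "\<dots> = (\<Sum>l<n. if l = i then of_bool (i = j) else 0)" by (intro sum.cong refl) auto
      also have "\<dots> = of_bool (i = j)" using ij by simp
      finally show "(P * transpose_mat P) $$ (i, j) = 1\<^sub>m n $$ (i, j)" using ij by simp
    qed (auto simp: P_def)
    show "transpose_mat P * P = 1\<^sub>m n"
    proof (rule eq_matI)
      fix i j assume "i < dim_row (1\<^sub>m n :: 'a mat)" "j < dim_col (1\<^sub>m n :: 'a mat)"
      then have ij: "i < n" "j < n" by auto
      have "(transpose_mat P * P) $$ (i, j) = (\<Sum>l<n. of_bool (l = \<pi> i) * of_bool (l = \<pi> j))"
        using ij by (simp add: P_def scalar_prod_def lessThan_atLeast0)
      also have "\<dots> = (\<Sum>l<n. if l = \<pi> i then of_bool (i = j) else 0)"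
        using ij inj by (intro sum.cong refl) auto
      also have "\<dots> = of_bool (i = j)" using ij lt by simp
      finally show "(transpose_mat P * P) $$ (i, j) = 1\<^sub>m n $$ (i, j)" using ij by simp
    qed (auto simp: P_def)
    show "A * P = P * ?B"
    proof (rule eq_matI)
      fix i j assume "i < dim_row (P * ?B)" "j < dim_col (P * ?B)"
      then have ij: "i < n" "j < n" by (auto simp: P_def)
      have "(A * P) $$ (i, j) = (\<Sum>l<n. A $$ (i, l) * of_bool (l = \<pi> j))"
        using ij A by (simp add: P_def scalar_prod_def lessThan_atLeast0)
      also have "\<dots> = (\<Sum>l<n. if l = \<pi> j then A $$ (i, \<pi> j) else 0)" by (intro sum.cong refl) auto
      also have "\<dots> = (\<Sum>l<n. if l = i then A $$ (i, \<pi> j) else 0)" using ij lt by simp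
      also have "\<dots> = (\<Sum>l<n. of_bool (i = l) * A $$ (l, \<pi> j))" by (intro sum.cong refl) auto
      also have "\<dots> = (\<Sum>l<n. of_bool (i = \<pi> l) * A $$ (\<pi> l, \<pi> j))" by (rule reindex[symmetric])
      also have "\<dots> = (P * ?B) $$ (i, j)"
        using ij by (simp add: P_def scalar_prod_def lessThan_atLeast0)
      finally show "(A * P) $$ (i, j) = (P * ?B) $$ (i, j)" .
    qed (use A in \<open>auto simp: P_def\<close>)
  qed (auto simp: P_def)
  then show ?thesis by simp
qed

text \<open>Here \<open>M\<close> is \<open>L\<close> plus the column \<open>g\<close> times the
  all-ones row. Bordering \<open>L\<close> and \<open>M\<close> by the column \<open>g\<close>, with
  corner entries \<open>c\<close> and \<open>0\<close>, gives two matrices that are conjugate under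
  adding the first \<open>n\<close> rows to the last one. Thus one eigenvalue \<open>0\<close> of
  \<open>L\<close> is traded for \<open>c\<close>.\<close>

lemma char_poly_rank_one_update:
  fixes L M :: "'a :: idom mat"
  assumes L: "L \<in> carrier_mat n n" and M: "M \<in> carrier_mat n n"
    and upd: "\<And>i j. i < n \<Longrightarrow> j < n \<Longrightarrow> M $$ (i, j) = L $$ (i, j) + g i"
    and col: "\<And>j. j < n \<Longrightarrow> (\<Sum>i<n. M $$ (i, j)) = c" and g: "(\<Sum>i<n. g i) = c"
  shows "char_poly L * [:- c, 1:] = char_poly M * [:0, 1:]"
proof -
  define G where "G = mat n 1 (\<lambda>(i, j). g i)"
  define U :: "'a mat" where "U = mat 1 n (\<lambda>(i, j). 1)"
  define C where "C x = mat 1 1 (\<lambda>(i, j). x)" for x :: 'a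
  have G: "G \<in> carrier_mat n 1" and U: "U \<in> carrier_mat 1 n" and C: "C x \<in> carrier_mat 1 1" for x
    by (auto simp: G_def U_def C_def)
  let ?W = "four_block_mat L G (0\<^sub>m 1 n) (C c)"
  let ?V = "four_block_mat M G (0\<^sub>m 1 n) (C 0)"
  let ?S = "four_block_mat (1\<^sub>m n) (0\<^sub>m n 1) U (1\<^sub>m 1)"
  let ?T = "four_block_mat (1\<^sub>m n) (0\<^sub>m n 1) (- U) (1\<^sub>m 1)"
  have cC: "char_poly (C x) = [:- x, 1:]" for x
    by (subst char_poly_upper_triangular[of _ 1]) (auto simp: C_def diag_mat_def)
  have "char_poly ?W = char_poly ?V"
  proof (rule char_poly_eq_if_intertwined[of _ "n + 1" _ ?S ?T])
    have UU: "U + - U = 0\<^sub>m 1 n" "- U + U = 0\<^sub>m 1 n" by (rule eq_matI; auto simp: U_def)+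
    show "?S * ?T = 1\<^sub>m (n + 1)"
      using U by (subst mult_four_block_mat[of _ n n _ 1 _ 1 _ _ n _ 1]) (auto simp: UU)
    show "?T * ?S = 1\<^sub>m (n + 1)"
      using U by (subst mult_four_block_mat[of _ n n _ 1 _ 1 _ _ n _ 1]) (auto simp: UU)
    have 1: "L + G * U = M"
      using L M upd by (intro eq_matI) (auto simp: G_def U_def scalar_prod_def)
    have 2: "C c * U = U * M"
      using M col by (intro eq_matI) (auto simp: C_def U_def scalar_prod_def lessThan_atLeast0)
    have 3: "C c = U * G"
      using g by (intro eq_matI) (auto simp: C_def U_def G_def scalar_prod_def lessThan_atLeast0)
    have 4: "U * G + C 0 = U * G" by (rule eq_matI) (auto simp: C_def U_def G_def)
    have "?W * ?S = four_block_mat (L * 1\<^sub>m n + G * U) (L * 0\<^sub>m n 1 + G * 1\<^sub>m 1)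
        (0\<^sub>m 1 n * 1\<^sub>m n + C c * U) (0\<^sub>m 1 n * 0\<^sub>m n 1 + C c * 1\<^sub>m 1)"
      by (rule mult_four_block_mat) (use L G U C in auto)
    also have "\<dots> = four_block_mat (L + G * U) G (C c * U) (C c)"
      using L G U C[of c] mult_carrier_mat[OF C[of c] U] by (intro cong_four_block_mat) auto
    also have "\<dots> = four_block_mat M G (U * M) (U * G)" by (rule cong_four_block_mat[OF 1 refl 2 3])
    also have "\<dots> = four_block_mat (1\<^sub>m n * M + 0\<^sub>m n 1 * 0\<^sub>m 1 n) (1\<^sub>m n * G + 0\<^sub>m n 1 * C 0)
        (U * M + 1\<^sub>m 1 * 0\<^sub>m 1 n) (U * G + 1\<^sub>m 1 * C 0)"
      using M G U C[of 0] mult_carrier_mat[OF U M] 4 by (intro cong_four_block_mat) auto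
    also have "\<dots> = ?S * ?V"
      by (rule mult_four_block_mat[symmetric]) (use M G U C in auto)
    finally show "?W * ?S = ?S * ?V" .
  qed (rule four_block_carrier_mat[OF L C] four_block_carrier_mat[OF M C]
      four_block_carrier_mat[OF one_carrier_mat one_carrier_mat])+
  then show ?thesis
    using char_poly_block_upper[OF L G C] char_poly_block_upper[OF M G C] cC by simp
qed

section \<open>Laplacian eigenvalues\<close>

lemma laplacian_carrier [simp]: "laplacian n E \<in> carrier_mat n n"
  by (simp add: laplacian_def)

lemma dim_laplacian [simp]: "dim_row (laplacian n E) = n" "dim_col (laplacian n E) = n"
  by (simp_all add: laplacian_def)

text \<open>The definite description is meaningful: symmetry gives existence, and unique
  factorization together with sorting gives uniqueness.\<close>

lemma lap_eigs:
  "length (lap_eigs n E) = n" "sorted_wrt (\<ge>) (lap_eigs n E)"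
  "char_poly (laplacian n E) = lin_prod (lap_eigs n E)"
proof -
  obtain ls where ls: "length ls = n" "char_poly (laplacian n E) = lin_prod ls"
    by (rule symmetric_char_poly_splits[of "laplacian n E" n])
       (auto simp: laplacian_def insert_commute)
  let ?P = "\<lambda>ls. length ls = n \<and> sorted_wrt (\<ge>) ls \<and> char_poly (laplacian n E) = lin_prod ls"
  have "\<exists>!ls. ?P ls"
  proof
    have "mset (rev (sort ls)) = mset ls" by simp
    then show "?P (rev (sort ls))"
      using ls lin_prod_mset_cong[of "rev (sort ls)" ls]
      by (simp add: sorted_wrt_rev)
  next
    fix ms assume ms: "?P ms"
    then have "mset ms = mset ls" using ls by (intro mset_eq_if_lin_prod_eq) simp
    moreover have "sorted (rev ms)" using ms by (simp add: sorted_wrt_rev)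
    ultimately have "rev ms = sort ls" by (intro properties_for_sort[symmetric]) auto
    then show "ms = rev (sort ls)" by (metis rev_rev_ident)
  qed
  from theI'[OF this, folded lap_eigs_def]
  show "length (lap_eigs n E) = n" "sorted_wrt (\<ge>) (lap_eigs n E)"
    "char_poly (laplacian n E) = lin_prod (lap_eigs n E)" by blast+
qed

text \<open>Allows lower bounds on a partial eigenvalue sum by exhibiting any at most
  \<open>k\<close> eigenvalues; nonnegativity covers smaller selections.\<close>

lemma sum_submset_le_sum_take:
  fixes ls :: "real list"
  assumes "sorted_wrt (\<ge>) ls" "M \<subseteq># mset ls" "size M \<le> k" "\<forall>l\<in>set ls. 0 \<le> l"
  shows "sum_mset M \<le> sum_list (take k ls)"
  using assms
proof (induction ls arbitrary: M k)
  case (Cons l ls)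
  show ?case
  proof (cases "M = {#}")
    case True
    have "0 \<le> sum_list (take k (l # ls))"
      using Cons.prems(4) by (intro sum_list_nonneg) (meson in_set_takeD)
    then show ?thesis using True by simp
  next
    case False
    then obtain k' where k: "k = Suc k'" using Cons.prems(3) by (cases k) auto
    \<comment> \<open>The head \<open>l\<close> is removed from \<open>M\<close> if it occurs there,
      otherwise an arbitrary element; either way \<open>x\<close> is at most \<open>l\<close> and
      the rest fits into \<open>ls\<close>.\<close>
    define x where "x = (if l \<in># M then l else (SOME x. x \<in># M))"
    have xM: "x \<in># M" using False by (auto simp: x_def some_in_eq intro: someI)
    then have M: "M = add_mset x (M - {#x#})" by simp
    have "x \<in> set (l # ls)" using xM Cons.prems(2) mset_subset_eqD by fastforce
    then have "x \<le> l" using Cons.prems(1) by auto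
    have "M - {#x#} \<subseteq># mset ls"
    proof (cases "l \<in># M")
      case True
      then show ?thesis using Cons.prems(2) by (simp add: x_def subset_eq_diff_conv)
    next
      case False
      then have "M \<subseteq># mset ls" using Cons.prems(2)
        by (metis diff_single_trivial mset.simps(2) subset_eq_diff_conv add_mset_add_single)
      then show ?thesis by (meson diff_subset_eq_self subset_mset.order_trans)
    qed
    moreover have "size (M - {#x#}) \<le> k'" using Cons.prems(3) xM k by (simp add: size_Diff_singleton)
    ultimately have "sum_mset (M - {#x#}) \<le> sum_list (take k' ls)"
      using Cons.prems by (intro Cons.IH) auto
    moreover have "sum_mset M = x + sum_mset (M - {#x#})" by (subst M) simp
    ultimately show ?thesis using \<open>x \<le> l\<close> k by simp
  qed
qed simp

lemma degree_eq_card_nbrs: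
  assumes "simple_graph V E" "i \<in> V"
  shows "degree E i = card {j \<in> V. j \<noteq> i \<and> {i, j} \<in> E}"
proof -
  have "bij_betw (\<lambda>j. {i, j}) {j \<in> V. j \<noteq> i \<and> {i, j} \<in> E} {e \<in> E. i \<in> e}"
    using assms unfolding simple_graph_def
    by (intro bij_betwI') (fastforce simp: doubleton_eq_iff insert_commute)+
  then show ?thesis unfolding degree_def by (simp add: bij_betw_same_card)
qed

definition adj :: "nat set set \<Rightarrow> nat \<Rightarrow> nat \<Rightarrow> real" where
  "adj E i j = of_bool (i \<noteq> j \<and> {i, j} \<in> E)"

lemma degree_eq_sum_adj:
  assumes "simple_graph {0..<n} E" "i < n"
  shows "real (degree E i) = (\<Sum>j<n. adj E i j)"
proof -
  have "(\<Sum>j<n. adj E i j) = (\<Sum>j\<in>{j \<in> {0..<n}. j \<noteq> i \<and> {i, j} \<in> E}. 1)"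
    unfolding adj_def lessThan_atLeast0 by (intro sum.mono_neutral_cong_right) auto
  then show ?thesis using degree_eq_card_nbrs[of "{0..<n}" E i] assms by simp
qed

lemma laplacian_mult_eq:
  assumes "simple_graph {0..<n} E" "i < n"
  shows "(\<Sum>j<n. laplacian n E $$ (i, j) * v j) = (\<Sum>j<n. adj E i j * (v i - v j))"
proof -
  have "(\<Sum>j<n. laplacian n E $$ (i, j) * v j)
      = (\<Sum>j<n. (if j = i then real (degree E i) * v i else 0) - adj E i j * v j)"
    using assms by (intro sum.cong refl) (auto simp: laplacian_def adj_def)
  also have "\<dots> = (\<Sum>j<n. adj E i j) * v i - (\<Sum>j<n. adj E i j * v j)"
    using assms degree_eq_sum_adj[OF assms] by (simp add: sum_subtractf)
  finally show ?thesis by (simp add: right_diff_distrib sum_subtractf sum_distrib_right)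
qed

lemma lap_eigs_eigenvector:
  assumes "simple_graph {0..<n} E" "x \<in> set (lap_eigs n E)"
  obtains v where "\<exists>i<n. v i \<noteq> 0" "\<And>i. i < n \<Longrightarrow> (\<Sum>j<n. adj E i j * (v i - v j)) = x * v i"
proof -
  have "poly (char_poly (laplacian n E)) x = 0"
    unfolding lap_eigs(3) using assms by (simp add: poly_lin_prod_eq_0_iff)
  then obtain v where "\<exists>i<n. v i \<noteq> 0"
      "\<And>i. i < n \<Longrightarrow> (\<Sum>j<n. laplacian n E $$ (i, j) * v j) = x * v i"
    by (rule ex_coord_eigenvector[OF laplacian_carrier]) blast
  then show thesis using that laplacian_mult_eq[OF assms(1)] by simp
qed

section \<open>Bounds on Laplacian eigenvalues by maximum principles\<close>

lemma ex_max_coord: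
  fixes v :: "nat \<Rightarrow> real"
  assumes "0 < n" obtains i where "i < n" "\<And>j. j < n \<Longrightarrow> v j \<le> v i"
proof -
  have "Max (v ` {..<n}) \<in> v ` {..<n}" using assms by (intro Max_in) auto
  then obtain i where "i < n" "v i = Max (v ` {..<n})" by force
  then show thesis using that[of i] by simp
qed

lemma adj_nonneg: "0 \<le> adj E i j" and adj_le_1: "adj E i j \<le> 1" and adj_commute: "adj E i j = adj E j i"
  by (auto simp: adj_def insert_commute)

text \<open>At a coordinate \<open>i\<close> where the eigenvector is largest in absolute value,
  every product \<open>(v i - v j) * v i\<close> is nonnegative, hence so is
  \<open>x * v i * v i\<close>.\<close>

lemma lap_eigs_nonneg:
  assumes "simple_graph {0..<n} E" "x \<in> set (lap_eigs n E)"
  shows "0 \<le> x"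
proof -
  obtain v where v0: "\<exists>i<n. v i \<noteq> 0"
    and v: "\<And>i. i < n \<Longrightarrow> (\<Sum>j<n. adj E i j * (v i - v j)) = x * v i"
    using lap_eigs_eigenvector[OF assms] by blast
  obtain i where i: "i < n" "\<And>j. j < n \<Longrightarrow> \<bar>v j\<bar> \<le> \<bar>v i\<bar>"
    by (rule ex_max_coord[of n "\<lambda>i. \<bar>v i\<bar>"]) (use v0 in auto)
  have "x * v i * v i = (\<Sum>j<n. adj E i j * ((v i - v j) * v i))"
    unfolding v[OF i(1), symmetric] sum_distrib_right by (simp add: mult.assoc)
  also have "\<dots> \<ge> 0"
  proof (rule sum_nonneg)
    fix j assume "j \<in> {..<n}"
    then have "v j * v i \<le> \<bar>v i\<bar> * \<bar>v i\<bar>"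
      using i(2)[of j] by (metis abs_ge_self abs_ge_zero abs_mult lessThan_iff mult_right_mono order_trans)
    then have "0 \<le> (v i - v j) * v i" by (simp add: algebra_simps)
    then show "0 \<le> adj E i j * ((v i - v j) * v i)" by (rule mult_nonneg_nonneg[OF adj_nonneg])
  qed
  finally have "0 \<le> x * (v i * v i)" by (simp add: mult.assoc)
  moreover have "v i \<noteq> 0" using v0 i by force
  then have "0 < v i * v i" using not_real_square_gt_zero[of "v i"] by blast
  ultimately show ?thesis by (simp add: zero_le_mult_iff)
qed

text \<open>An eigenvector for a nonzero eigenvalue has coordinate sum \<open>0\<close>. At its
  maximal coordinate, raising all weights to \<open>1\<close> compares the graph with the complete
  graph, where the value is \<open>n * v i\<close>.\<close>

lemma lap_eigs_le:
  assumes "simple_graph {0..<n} E" "x \<in> set (lap_eigs n E)"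
  shows "x \<le> n"
proof (cases "x = 0")
  case False
  obtain v where v0: "\<exists>i<n. v i \<noteq> 0"
    and v: "\<And>i. i < n \<Longrightarrow> (\<Sum>j<n. adj E i j * (v i - v j)) = x * v i"
    using lap_eigs_eigenvector[OF assms] by blast
  have "x * (\<Sum>i<n. v i) = (\<Sum>i<n. \<Sum>j<n. adj E i j * (v i - v j))"
    unfolding sum_distrib_left by (intro sum.cong refl) (simp add: v)
  also have "\<dots> = (\<Sum>i<n. \<Sum>j<n. adj E i j * v i) - (\<Sum>i<n. \<Sum>j<n. adj E j i * v j)"
    by (simp add: sum_subtractf right_diff_distrib adj_commute)
  also have "(\<Sum>i<n. \<Sum>j<n. adj E j i * v j) = (\<Sum>i<n. \<Sum>j<n. adj E i j * v i)" by (rule sum.swap)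
  finally have sum0: "(\<Sum>i<n. v i) = 0" using False by simp
  obtain i where i: "i < n" "\<And>j. j < n \<Longrightarrow> v j \<le> v i"
    by (rule ex_max_coord[of n v]) (use v0 in auto)
  have "0 < v i"
  proof (rule ccontr)
    assume "\<not> 0 < v i"
    then have "\<forall>j\<in>{..<n}. v j \<le> 0" using i(2) by force
    then have "\<forall>j\<in>{..<n}. v j = 0" using sum0 sum_nonneg_eq_0_iff[of "{..<n}" "\<lambda>j. - v j"] by (simp add: sum_negf)
    then show False using v0 by auto
  qed
  have "x * v i \<le> (\<Sum>j<n. 1 * (v i - v j))"
    unfolding v[OF i(1), symmetric] using i by (intro sum_mono mult_right_mono adj_le_1) auto
  also have "\<dots> = n * v i" using sum0 by (simp add: sum_subtractf)
  finally show ?thesis using \<open>0 < v i\<close> by simp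
qed simp

lemma sum_degrees:
  fixes n :: nat
  assumes "simple_graph {0..<n} E"
  shows "(\<Sum>i<n. real (degree E i)) = 2 * real (card E)"
proof -
  have sub: "E \<subseteq> Pow {0..<n}" using assms by (auto simp: simple_graph_def)
  then have fin: "finite E" by (rule finite_subset) simp
  have "(\<Sum>i<n. degree E i) = (\<Sum>i<n. \<Sum>e\<in>E. of_bool (i \<in> e))"
    using fin by (simp add: degree_def sum.If_cases of_bool_def Int_def)
  also have "\<dots> = (\<Sum>e\<in>E. \<Sum>i<n. of_bool (i \<in> e))" by (rule sum.swap)
  also have "\<dots> = (\<Sum>e\<in>E. 2)"
  proof (rule sum.cong[OF refl])
    fix e assume e: "e \<in> E"
    then have "{..<n} \<inter> {i. i \<in> e} = e" using sub by fastforce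
    moreover have "card e = 2" using e assms by (auto simp: simple_graph_def)
    ultimately show "(\<Sum>i<n. of_bool (i \<in> e)) = (2::nat)" by (simp add: of_bool_def sum.If_cases)
  qed
  also have "\<dots> = 2 * card E" by simp
  finally show ?thesis unfolding of_nat_sum[symmetric] by simp
qed

lemma sum_lap_eigs:
  assumes "simple_graph {0..<n} E"
  shows "sum_list (lap_eigs n E) = 2 * real (card E)"
  using sum_list_eq_trace[OF laplacian_carrier lap_eigs(3)] sum_degrees[OF assms]
  by (simp add: laplacian_def)

lemma lap_eig_sum_le_edges:
  assumes "simple_graph {0..<n} E"
  shows "lap_eig_sum n E k \<le> 2 * real (card E)"
proof -
  have "0 \<le> sum_list (drop k (lap_eigs n E))"
    using lap_eigs_nonneg[OF assms] by (intro sum_list_nonneg) (meson in_set_dropD)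
  moreover have "sum_list (lap_eigs n E) = lap_eig_sum n E k + sum_list (drop k (lap_eigs n E))"
    unfolding lap_eig_sum_def by (metis append_take_drop_id sum_list_append)
  ultimately show ?thesis using sum_lap_eigs[OF assms] by simp
qed

text \<open>Each summand is at most \<open>c\<close> plus its excess over \<open>c\<close>. Applied
  with \<open>c\<close> the number of nodes and with \<open>c\<close> the size of the
  clique.\<close>

lemma sum_take_le:
  fixes ls :: "real list"
  assumes "0 \<le> c"
  shows "sum_list (take k ls) \<le> k * c + sum_list (map (\<lambda>l. max 0 (l - c)) ls)"
proof (induction ls arbitrary: k)
  case (Cons l ls)
  have "0 \<le> sum_list (map (\<lambda>l. max 0 (l - c)) ls)" by (intro sum_list_nonneg) auto
  then show ?case using Cons[of "k - 1"] by (cases k) (auto simp: algebra_simps)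
qed (use assms in simp)

lemma lap_eig_sum_le_nodes:
  assumes "simple_graph {0..<n} E"
  shows "lap_eig_sum n E k \<le> k * n"
proof -
  have *: "map (\<lambda>l. max 0 (l - real n)) (lap_eigs n E) = map (\<lambda>_. 0) (lap_eigs n E)"
    using lap_eigs_le[OF assms] by (intro map_cong) auto
  have "sum_list (map (\<lambda>l. max 0 (l - real n)) (lap_eigs n E)) = 0" unfolding * by simp
  then show ?thesis unfolding lap_eig_sum_def using sum_take_le[of n k "lap_eigs n E"] by simp
qed

section \<open>Threshold graphs\<close>

text \<open>The threshold graph obtained by adding \<open>0, 1, ..., n - 1\<close> in this order,
  where \<open>j\<close> is added as a dominating node exactly if \<open>j\<close> lies in
  \<open>S\<close>.\<close>

definition thr :: "nat \<Rightarrow> nat set \<Rightarrow> nat set set" where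
  "thr n S = {{i, j} | i j. i < j \<and> j < n \<and> j \<in> S}"

lemma thr_0: "thr 0 S = {}" by (simp add: thr_def)

lemma thr_Suc: "thr (Suc n) S = (if n \<in> S then thr n S \<union> {{u, n} | u. u \<in> {0..<n}} else thr n S)"
  unfolding thr_def by (auto simp: less_Suc_eq)

lemma threshold_graph_thr: "threshold_graph {0..<n} (thr n S)"
proof (induction n)
  case 0
  show ?case by (simp add: thr_0 threshold_graph.empty)
next
  case (Suc n)
  then show ?case
    using threshold_graph.add_isolated[of "{0..<n}" "thr n S" n]
      threshold_graph.add_dominating[of "{0..<n}" "thr n S" n]
    by (auto simp: thr_Suc atLeast0_lessThan_Suc)
qed

lemma simple_graph_thr: "simple_graph {0..<n} (thr n S)"
  unfolding simple_graph_def thr_def by fastforce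

text \<open>A dominating node \<open>j\<close> brings \<open>j\<close> edges, so prescribing the
  number of edges becomes a subset sum problem.\<close>

lemma card_thr: "card (thr n S) = \<Sum>(S \<inter> {..<n})"
proof (induction n)
  case (Suc n)
  have fin: "finite (thr n S)"
    by (rule finite_subset[of _ "Pow {0..<n}"]) (auto simp: thr_def)
  have "card {{u, n} | u. u \<in> {0..<n}} = n"
  proof -
    have "{{u, n} | u. u \<in> {0..<n}} = (\<lambda>u. {u, n}) ` {0..<n}" by auto
    moreover have "inj_on (\<lambda>u. {u, n}) {0..<n}" by (auto simp: inj_on_def doubleton_eq_iff)
    ultimately show ?thesis by (simp add: card_image)
  qed
  moreover have "thr n S \<inter> {{u, n} | u. u \<in> {0..<n}} = {}" by (auto simp: thr_def doubleton_eq_iff)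
  ultimately have "card (thr n S \<union> {{u, n} | u. u \<in> {0..<n}}) = card (thr n S) + n"
    using fin by (subst card_Un_disjoint) auto
  moreover have "S \<inter> {..<Suc n} = (if n \<in> S then insert n (S \<inter> {..<n}) else S \<inter> {..<n})"
    by (auto simp: less_Suc_eq)
  ultimately show ?case using Suc by (simp add: thr_Suc)
qed (simp add: thr_0)

lemma mem_thr_iff: "i < j \<Longrightarrow> {i, j} \<in> thr n S \<longleftrightarrow> j < n \<and> j \<in> S"
  by (auto simp: thr_def doubleton_eq_iff)

lemma adj_thr: "i < n \<Longrightarrow> j < n \<Longrightarrow> adj (thr n S) i j = of_bool (i \<noteq> j \<and> max i j \<in> S)"
  using mem_thr_iff[of i j n S] mem_thr_iff[of j i n S]
  by (cases i j rule: linorder_cases) (auto simp: adj_def insert_commute)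

text \<open>For \<open>j\<close> from \<open>1\<close> to \<open>n - 1\<close> these vectors form an
  orthogonal basis of the complement of the constant vectors, the same one for every
  \<open>S\<close>.\<close>

definition thr_vec :: "nat \<Rightarrow> nat \<Rightarrow> real" where
  "thr_vec j i = (if i < j then 1 else if i = j then - real j else 0)"

definition thr_eig :: "nat \<Rightarrow> nat set \<Rightarrow> nat \<Rightarrow> real" where
  "thr_eig n S j = of_bool (j \<in> S) * (j + 1) + real (card {l \<in> S. j < l \<and> l < n})"

lemma thr_eigenvector:
  assumes "i < n" "j < n"
  shows "(\<Sum>l<n. adj (thr n S) i l * (thr_vec j i - thr_vec j l)) = thr_eig n S j * thr_vec j i"
proof -
  let ?f = "\<lambda>l. adj (thr n S) i l * (thr_vec j i - thr_vec j l)"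
  have n: "{..<n} = {..<j} \<union> insert j {j<..<n}" using assms by auto
  have "(\<Sum>l<n. ?f l) = (\<Sum>l<j. ?f l) + (\<Sum>l\<in>insert j {j<..<n}. ?f l)"
    unfolding n by (rule sum.union_disjoint) auto
  then have split: "(\<Sum>l<n. ?f l) = (\<Sum>l<j. ?f l) + ?f j + (\<Sum>l\<in>{j<..<n}. ?f l)" by simp
  show ?thesis
  proof (cases "i \<le> j")
    case True
    have "(\<Sum>l\<in>{j<..<n}. ?f l) = (\<Sum>l\<in>{j<..<n}. of_bool (l \<in> S) * thr_vec j i)"
      using True assms by (intro sum.cong refl) (auto simp: adj_thr thr_vec_def max_def)
    also have "\<dots> = real (card {l \<in> S. j < l \<and> l < n}) * thr_vec j i"
    proof -
      have "{j<..<n} \<inter> S = {l \<in> S. j < l \<and> l < n}" by auto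
      then show ?thesis by (simp add: sum_distrib_right[symmetric] of_bool_def sum.If_cases Int_def conj_commute)
    qed
    finally have up: "(\<Sum>l\<in>{j<..<n}. ?f l) = real (card {l \<in> S. j < l \<and> l < n}) * thr_vec j i" .
    have "(\<Sum>l<j. ?f l) + ?f j = of_bool (j \<in> S) * (j + 1) * thr_vec j i"
    proof (cases "i = j")
      case True
      have "(\<Sum>l<j. ?f l) = (\<Sum>l<j. of_bool (j \<in> S) * (- real j - 1))"
        using True assms by (intro sum.cong refl) (auto simp: adj_thr thr_vec_def max_def)
      then show ?thesis using True by (simp add: thr_vec_def algebra_simps)
    next
      case False
      have "(\<Sum>l<j. ?f l) = 0"
        using False \<open>i \<le> j\<close> by (intro sum.neutral) (auto simp: thr_vec_def)
      then show ?thesis using False \<open>i \<le> j\<close> assms by (auto simp: adj_thr thr_vec_def max_def)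
    qed
    then show ?thesis using split up by (simp add: thr_eig_def algebra_simps)
  next
    \<comment> \<open>A node \<open>i\<close> above \<open>j\<close> sees all of \<open>0..j\<close>
      or none of it, and the entries of \<open>thr_vec j\<close> sum to zero there.\<close>
    case False
    have "(\<Sum>l<j. ?f l) = (\<Sum>l<j. - of_bool (i \<in> S))"
      using False assms by (intro sum.cong refl) (auto simp: adj_thr thr_vec_def max_def)
    moreover have "(\<Sum>l\<in>{j<..<n}. ?f l) = 0"
      using False by (intro sum.neutral) (auto simp: thr_vec_def)
    ultimately show ?thesis using split False assms by (auto simp: adj_thr thr_vec_def max_def)
  qed
qed

text \<open>Expressed in a basis containing the eigenvectors \<open>thr_vec j\<close>, the Laplacian
  is diagonal up to column \<open>0\<close>. The eigenvalue belonging to that column is recorded as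
  \<open>x\<close> without computing it.\<close>

lemma char_poly_thr:
  assumes "0 < n"
  obtains x where "char_poly (laplacian n (thr n S)) = lin_prod (x # map (thr_eig n S) [1..<n])"
proof -
  let ?L = "laplacian n (thr n S)"
  \<comment> \<open>Since \<open>thr_vec 0\<close> is the zero vector, column \<open>0\<close> is
    the first unit vector; this keeps \<open>P\<close> upper triangular with nonzero diagonal, hence
    invertible.\<close>
  define P :: "real mat" where
    "P = mat n n (\<lambda>(i, j). if j = 0 then of_bool (i = 0) else thr_vec j i)"
  have P: "P \<in> carrier_mat n n" by (simp add: P_def)
  have "upper_triangular P" by (auto simp: P_def thr_vec_def)
  then have "det P = prod_list (diag_mat P)" using P by (rule det_upper_triangular)
  also have "\<dots> \<noteq> 0" by (auto simp: prod_list_zero_iff diag_mat_def P_def thr_vec_def)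
  finally obtain Q where Q: "Q \<in> carrier_mat n n" "P * Q = 1\<^sub>m n" "Q * P = 1\<^sub>m n"
    using det_non_zero_imp_unit[OF P, where b = "()"] by (auto simp: Units_def ring_mat_def)
  define X where "X = Q * (?L * P)"
  have X: "X \<in> carrier_mat n n"
    unfolding X_def by (rule mult_carrier_mat[OF Q(1) mult_carrier_mat[OF laplacian_carrier P]])
  have "P * X = (P * Q) * (?L * P)"
    unfolding X_def
    by (rule assoc_mult_mat[OF P Q(1) mult_carrier_mat[OF laplacian_carrier P], symmetric])
  then have LP: "?L * P = P * X"
    using left_mult_one_mat[OF mult_carrier_mat[OF laplacian_carrier P]] Q by simp
  have cp: "char_poly ?L = char_poly X"
    by (rule char_poly_eq_if_intertwined[OF laplacian_carrier X P Q LP])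
  have col: "X $$ (i, j) = (if i = j then thr_eig n S j else 0)" if "i < n" "j < n" "j \<noteq> 0" for i j
  proof -
    have LPj: "(?L * P) $$ (l, j) = thr_eig n S j * P $$ (l, j)" if l: "l < n" for l
    proof -
      have "(?L * P) $$ (l, j) = (\<Sum>p<n. ?L $$ (l, p) * thr_vec j p)"
        using l \<open>j < n\<close> \<open>j \<noteq> 0\<close>
        by (simp add: scalar_prod_def lessThan_atLeast0 P_def)
      also have "\<dots> = thr_eig n S j * thr_vec j l"
        using laplacian_mult_eq[OF simple_graph_thr l] thr_eigenvector[OF l \<open>j < n\<close>] by simp
      finally show ?thesis using l \<open>j < n\<close> \<open>j \<noteq> 0\<close> by (simp add: P_def)
    qed
    have "X $$ (i, j) = (\<Sum>l<n. Q $$ (i, l) * (?L * P) $$ (l, j))"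
      unfolding X_def using that P Q
      by (subst index_mult_mat) (auto simp: scalar_prod_def lessThan_atLeast0 laplacian_def)
    also have "\<dots> = thr_eig n S j * (\<Sum>l<n. Q $$ (i, l) * P $$ (l, j))"
      unfolding sum_distrib_left by (intro sum.cong refl) (simp add: LPj)
    also have "(\<Sum>l<n. Q $$ (i, l) * P $$ (l, j)) = (Q * P) $$ (i, j)"
      using that P Q(1) by (subst index_mult_mat) (auto simp: scalar_prod_def lessThan_atLeast0)
    finally show ?thesis using that Q by simp
  qed
  have "char_poly X = char_poly (transpose_mat X)" using char_poly_transpose_mat[OF X] by simp
  also have "\<dots> = lin_prod (diag_mat (transpose_mat X))"
    using X col by (intro char_poly_upper_triangular[of _ n]) auto
  also have "diag_mat (transpose_mat X) = X $$ (0, 0) # map (thr_eig n S) [1..<n]"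
    using X col assms by (auto simp: diag_mat_def upt_conv_Cons intro!: map_cong)
  finally show thesis using that cp by simp
qed

lemma thr_eig_sum_ge:
  assumes "J \<subseteq> {1..<n}" "card J \<le> k"
  shows "(\<Sum>j\<in>J. thr_eig n S j) \<le> lap_eig_sum n (thr n S) k"
proof (cases "n = 0")
  case True
  then show ?thesis using assms lap_eigs(1)[of 0] by (simp add: lap_eig_sum_def)
next
  case False
  let ?ls = "lap_eigs n (thr n S)"
  have fin: "finite J" using assms by (rule_tac finite_subset) auto
  obtain x where "char_poly (laplacian n (thr n S)) = lin_prod (x # map (thr_eig n S) [1..<n])"
    using char_poly_thr False by blast
  then have "mset ?ls = mset (x # map (thr_eig n S) [1..<n])"
    using lap_eigs(3)[of n "thr n S"] by (intro mset_eq_if_lin_prod_eq) simp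
  also have "\<dots> = add_mset x (image_mset (thr_eig n S) (mset_set {1..<n}))"
    by simp
  finally have ls: "mset ?ls = add_mset x (image_mset (thr_eig n S) (mset_set {1..<n}))" .
  have "image_mset (thr_eig n S) (mset_set J) \<subseteq># image_mset (thr_eig n S) (mset_set {1..<n})"
    using assms fin by (intro image_mset_subseteq_mono subset_imp_msubset_mset_set) auto
  also have "\<dots> \<subseteq># mset ?ls" unfolding ls by simp
  finally have "sum_mset (image_mset (thr_eig n S) (mset_set J)) \<le> sum_list (take k ?ls)"
    using assms lap_eigs_nonneg[OF simple_graph_thr] lap_eigs(2)
    by (intro sum_submset_le_sum_take) auto
  then show ?thesis by (simp add: lap_eig_sum_def sum_unfold_sum_mset)
qed

section \<open>Triangular numbers and subset sums of initial segments\<close>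

abbreviation tri :: "nat \<Rightarrow> nat" where "tri k \<equiv> \<Sum>{1..k}"

lemma tri_Suc: "tri (Suc k) = tri k + Suc k" by simp

lemma two_tri: "2 * tri k = k * (k + 1)" by (induction k) auto

lemma tri_superadditive: "tri x + tri y \<le> tri (x + y)" by (induction y) auto

text \<open>Greedy choice: the largest number is taken exactly when the smaller ones cannot reach
  \<open>m\<close>.\<close>

lemma ex_subset_sum:
  "m \<le> tri N \<Longrightarrow> \<exists>S\<subseteq>{1..N}. \<Sum>S = m"
proof (induction N arbitrary: m)
  case (Suc N)
  show ?case
  proof (cases "m \<le> tri N")
    case True
    then obtain S where "S \<subseteq> {1..N}" "\<Sum>S = m" using Suc.IH by blast
    then show ?thesis by (intro exI[of _ S]) auto
  next
    case False
    have "N \<le> tri N" by (cases N) auto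
    then have "Suc N \<le> m" using False by simp
    moreover have "m - Suc N \<le> tri N" using Suc.prems by simp
    then obtain S where S: "S \<subseteq> {1..N}" "\<Sum>S = m - Suc N" using Suc.IH by blast
    moreover have "finite S" "Suc N \<notin> S" using S finite_subset by auto
    ultimately show ?thesis by (intro exI[of _ "insert (Suc N) S"]) auto
  qed
qed auto

text \<open>The sums of \<open>k\<close>-element subsets fill the whole interval between the
  \<open>k\<close> smallest and the \<open>k\<close> largest numbers. The upper end is stated
  additively to avoid truncated subtraction.\<close>

lemma ex_subset_card_sum:
  "k \<le> N \<Longrightarrow> tri k \<le> m \<Longrightarrow> m + tri (N - k) \<le> tri N \<Longrightarrow> \<exists>S\<subseteq>{1..N}. card S = k \<and> \<Sum>S = m"
proof (induction N arbitrary: m k)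
  case (Suc N)
  show ?case
  proof (cases "k = Suc N")
    case True
    then show ?thesis using Suc.prems by (intro exI[of _ "{1..Suc N}"]) auto
  next
    case False
    then have kN: "k \<le> N" using Suc.prems by simp
    show ?thesis
    proof (cases "m + tri (N - k) \<le> tri N")
      case True
      then obtain S where "S \<subseteq> {1..N}" "card S = k" "\<Sum>S = m" using Suc.IH[OF kN] Suc.prems by blast
      then show ?thesis by (intro exI[of _ S]) auto
    next
      case False
      obtain k' where k: "k = Suc k'" using False Suc.prems(3) by (cases k) auto
      define p where "p = N - k"
      have N: "N = Suc (k' + p)" using kN k by (simp add: p_def)
      \<comment> \<open>Superadditivity ensures that, once \<open>Suc N\<close> is taken, the
        remainder still reaches the minimum \<open>tri k'\<close> for \<open>k'\<close>
        elements.\<close>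
      have "tri k' + tri p + N \<le> tri N" using tri_superadditive[of k' p] unfolding N tri_Suc by simp
      then have m: "tri k' + Suc N \<le> m" using False by (simp add: p_def)
      have "Suc N - k = N - k'" using k by simp
      then have "m - Suc N + tri (N - k') \<le> tri N" using Suc.prems(3) m by simp
      then obtain S where S: "S \<subseteq> {1..N}" "card S = k'" "\<Sum>S = m - Suc N"
        using Suc.IH[of k' "m - Suc N"] le_diff_conv2[of "Suc N" m "tri k'"] m kN k
        by (metis Suc_leD add_leD2)
      moreover have "finite S" "Suc N \<notin> S" using S finite_subset by auto
      ultimately show ?thesis using m k by (intro exI[of _ "insert (Suc N) S"]) auto
    qed
  qed
qed auto

lemma card_le_tri:
  assumes "simple_graph {0..<n} E"
  shows "card E \<le> tri (n - 1)"
proof -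
  have "E \<subseteq> thr n UNIV"
  proof
    fix e assume "e \<in> E"
    then obtain u v where "e = {u, v}" "u < n" "v < n" "u \<noteq> v"
      using assms by (auto simp: simple_graph_def)
    then show "e \<in> thr n UNIV"
      using mem_thr_iff[of u v n UNIV] mem_thr_iff[of v u n UNIV]
      by (cases u v rule: linorder_cases) (auto simp: insert_commute)
  qed
  moreover have "finite (thr n UNIV)"
    by (rule finite_subset[of _ "Pow {0..<n}"]) (auto simp: thr_def)
  ultimately have "card E \<le> \<Sum>{..<n}" using card_mono card_thr[of n UNIV] by fastforce
  also have "\<Sum>{..<n} = tri (n - 1)" by (rule sum.mono_neutral_right) auto
  finally show ?thesis .
qed

text \<open>Three ranges of the edge number match three upper bounds: for few edges \<open>S\<close>
  lies in \<open>{1..k}\<close> and attains the full trace, in the middle range \<open>S\<close> has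
  exactly \<open>k\<close> elements and attains Brouwer's bound, and for many edges \<open>S\<close>
  contains the \<open>k\<close> largest indices and attains \<open>k * n\<close>.\<close>

lemma spectrally_threshold_dominatedI:
  assumes E: "simple_graph {0..<n} E"
    and brouwer: "\<And>k. k < n \<Longrightarrow> lap_eig_sum n E k \<le> card E + tri k"
  shows "spectrally_threshold_dominated n E"
  unfolding spectrally_threshold_dominated_def
proof
  fix k assume k: "k \<in> {1..n}"
  let ?m = "card E"
  have "\<exists>S\<subseteq>{1..<n}. \<Sum>S = ?m \<and> lap_eig_sum n E k \<le> lap_eig_sum n (thr n S) k"
  proof (cases "?m \<le> tri (min k (n - 1))")
    case True
    define K where "K = min k (n - 1)"
    obtain S where S: "S \<subseteq> {1..K}" "\<Sum>S = ?m" using ex_subset_sum True K_def by blast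
    have KN: "{1..K} \<subseteq> {1..<n}" using k by (auto simp: K_def)
    have finS: "finite S" using S finite_subset by blast
    \<comment> \<open>Double counting: an \<open>l\<close> in \<open>S\<close> counts
      \<open>l + 1\<close> at its own index and \<open>1\<close> at each of the \<open>l - 1\<close>
      smaller indices, in total \<open>2 * l\<close>.\<close>
    have "(\<Sum>j\<in>{1..K}. real (card {l \<in> S. j < l \<and> l < n})) = (\<Sum>j\<in>{1..K}. \<Sum>l\<in>S. of_bool (j < l))"
    proof (intro sum.cong refl)
      fix j assume "j \<in> {1..K}"
      have "S \<inter> {l. j < l} = {l \<in> S. j < l \<and> l < n}" using S KN by auto
      then show "real (card {l \<in> S. j < l \<and> l < n}) = (\<Sum>l\<in>S. of_bool (j < l))"
        using finS by (simp add: of_bool_def sum.If_cases)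
    qed
    also have "\<dots> = (\<Sum>l\<in>S. \<Sum>j\<in>{1..K}. of_bool (j < l))" by (rule sum.swap)
    also have "\<dots> = (\<Sum>l\<in>S. real l - 1)"
    proof (intro sum.cong refl)
      fix l assume l: "l \<in> S"
      then have "{1..K} \<inter> {j. j < l} = {1..<l}" "1 \<le> l" using S by auto
      then show "(\<Sum>j\<in>{1..K}. of_bool (j < l)) = real l - 1"
        by (simp add: of_bool_def sum.If_cases of_nat_diff)
    qed
    finally have up: "(\<Sum>j\<in>{1..K}. real (card {l \<in> S. j < l \<and> l < n})) = (\<Sum>l\<in>S. real l - 1)" .
    have "(\<Sum>j\<in>{1..K}. of_bool (j \<in> S) * (real j + 1)) = (\<Sum>j\<in>S. real j + 1)"
      using S by (intro sum.mono_neutral_cong_right) auto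
    then have "(\<Sum>j\<in>{1..K}. thr_eig n S j) = (\<Sum>l\<in>S. real l + 1) + (\<Sum>l\<in>S. real l - 1)"
      unfolding thr_eig_def sum.distrib up by simp
    also have "\<dots> = (\<Sum>l\<in>S. 2 * real l)" unfolding sum.distrib[symmetric] by simp
    also have "\<dots> = 2 * real ?m" by (simp add: S(2)[symmetric] sum_distrib_left)
    finally have "2 * real ?m \<le> lap_eig_sum n (thr n S) k"
      using thr_eig_sum_ge[of "{1..K}" n k S] KN by (simp add: K_def)
    then show ?thesis using S KN lap_eig_sum_le_edges[OF E, of k] by (intro exI[of _ S]) auto
  next
    case False
    \<comment> \<open>For larger \<open>k\<close> the failed case condition would contradict the
      maximal number of edges, \<open>tri (n - 1)\<close>.\<close>
    have kn: "k < n - 1"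
    proof (rule ccontr)
      assume "\<not> k < n - 1"
      then show False using False card_le_tri[OF E] by (simp add: min_def split: if_splits)
    qed
    then have mk: "tri k \<le> ?m" using False by (simp add: min_def)
    have interval: "{1..n - 1} = {1..<n}" using kn by auto
    show ?thesis
    proof (cases "?m + tri (n - 1 - k) \<le> tri (n - 1)")
      case True
      then obtain S where S: "S \<subseteq> {1..<n}" "card S = k" "\<Sum>S = ?m"
        using ex_subset_card_sum[of k "n - 1" ?m] kn mk unfolding interval by auto
      have finS: "finite S" using S finite_subset by blast
      \<comment> \<open>\<open>?X\<close> counts the pairs \<open>j < l\<close> in \<open>S\<close>;
        together with the \<open>k\<close> ones from the terms \<open>j + 1\<close> it gives
        \<open>tri k\<close>.\<close>
      let ?X = "\<Sum>j\<in>S. \<Sum>l\<in>S. of_bool (j < l) :: real"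
      have "?X + ?X = (\<Sum>j\<in>S. \<Sum>l\<in>S. of_bool (j < l)) + (\<Sum>j\<in>S. \<Sum>l\<in>S. of_bool (l < j))"
        by (subst (2) sum.swap) simp
      also have "\<dots> = (\<Sum>j\<in>S. \<Sum>l\<in>S. 1 - of_bool (l = j))"
        unfolding sum.distrib[symmetric] by (intro sum.cong refl) auto
      also have "\<dots> = (\<Sum>j\<in>S. real k - 1)"
        using finS S(2) by (intro sum.cong refl) (simp add: sum_subtractf of_bool_def)
      finally have X: "2 * ?X = real k * (real k - 1)" using S(2) by simp
      have "(\<Sum>j\<in>S. thr_eig n S j) = (\<Sum>j\<in>S. (real j + 1) + (\<Sum>l\<in>S. of_bool (j < l)))"
      proof (intro sum.cong refl)
        fix j assume j: "j \<in> S"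
        have "S \<inter> {l. j < l} = {l \<in> S. j < l \<and> l < n}" using S by auto
        then show "thr_eig n S j = (real j + 1) + (\<Sum>l\<in>S. of_bool (j < l))"
          using finS j by (simp add: thr_eig_def of_bool_def sum.If_cases)
      qed
      also have "\<dots> = ?m + k + ?X" using S by (simp add: sum.distrib S(3)[symmetric])
      also have "\<dots> = ?m + tri k"
      proof -
        have "2 * real (tri k) = real k * (real k + 1)"
          using arg_cong[OF two_tri[of k], of real] by (simp add: algebra_simps)
        then show ?thesis using X by (simp add: algebra_simps)
      qed
      finally have "?m + tri k \<le> lap_eig_sum n (thr n S) k"
        using thr_eig_sum_ge[of S n k S] S by simp
      moreover have "lap_eig_sum n E k \<le> ?m + tri k" using kn by (intro brouwer) simp
      ultimately have "lap_eig_sum n E k \<le> lap_eig_sum n (thr n S) k" by linarith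
      then show ?thesis using S by blast
    next
      case False
      let ?T = "{n - k..<n}"
      have top: "\<Sum>?T + tri (n - 1 - k) = tri (n - 1)"
      proof -
        have "{1..n - 1} = {1..n - 1 - k} \<union> ?T" "{1..n - 1 - k} \<inter> ?T = {}" using kn by auto
        then show ?thesis using sum.union_disjoint[of "{1..n - 1 - k}" ?T "\<lambda>x. x"] by simp
      qed
      \<comment> \<open>The edges left over by the top \<open>k\<close> indices fit into the indices
        below them.\<close>
      have "?m - \<Sum>?T \<le> tri (n - 1 - k)" using card_le_tri[OF E] top by simp
      then obtain S' where S': "S' \<subseteq> {1..n - 1 - k}" "\<Sum>S' = ?m - \<Sum>?T" using ex_subset_sum by blast
      have fin: "finite S'" using S' finite_subset by blast
      define S where "S = S' \<union> ?T"
      have "{1..n - 1 - k} \<inter> ?T = {}" using kn by auto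
      then have "S' \<inter> ?T = {}" using S'(1) by blast
      then have sumS: "\<Sum>S = ?m" using S' fin False top by (simp add: S_def sum.union_disjoint)
      have TN: "?T \<subseteq> {1..<n}" and "{1..n - 1 - k} \<subseteq> {1..<n}" using kn by auto
      then have SN: "S \<subseteq> {1..<n}" using S'(1) unfolding S_def by blast
      \<comment> \<open>All indices above \<open>j\<close> belong to \<open>S\<close>, so the
        eigenvalue is \<open>(j + 1) + (n - 1 - j)\<close>.\<close>
      have "(\<Sum>j\<in>?T. thr_eig n S j) = (\<Sum>j\<in>?T. real n)"
      proof (intro sum.cong refl)
        fix j assume j: "j \<in> ?T"
        then have "{l \<in> S. j < l \<and> l < n} = {Suc j..<n}" by (auto simp: S_def)
        then show "thr_eig n S j = real n" using j by (simp add: thr_eig_def S_def of_nat_diff)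
      qed
      also have "\<dots> = k * n" using kn by simp
      finally have "k * n \<le> lap_eig_sum n (thr n S) k"
        using thr_eig_sum_ge[OF TN, of k S] kn by simp
      then show ?thesis using SN sumS lap_eig_sum_le_nodes[OF E, of k] by (intro exI[of _ S]) auto
    qed
  qed
  then obtain S where S: "S \<subseteq> {1..<n}" "\<Sum>S = ?m" "lap_eig_sum n E k \<le> lap_eig_sum n (thr n S) k"
    by blast
  have "S \<inter> {..<n} = S" using S by auto
  then have "card (thr n S) = ?m" using card_thr[of n S] S by simp
  then show "\<exists>T. threshold_graph {0..<n} T \<and> card T = card E \<and> lap_eig_sum n E k \<le> lap_eig_sum n T k"
    using threshold_graph_thr S by blast
qed

section \<open>The Riccati equation of a bipartite graph\<close>

text \<open>The vector is a truncated Neumann series; the truncation error is absorbed by its first summand \<open>1\<close>.\<close>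

lemma ex_pos_superinvariant:
  fixes P :: "'i \<Rightarrow> 'i \<Rightarrow> real"
  assumes "finite I" and nonneg: "\<And>i j. i \<in> I \<Longrightarrow> j \<in> I \<Longrightarrow> 0 \<le> P i j"
    and col: "\<And>j. j \<in> I \<Longrightarrow> (\<Sum>i\<in>I. P i j) \<le> c"
    and "0 \<le> c" "0 < \<epsilon>"
  obtains u where "\<And>i. i \<in> I \<Longrightarrow> 0 < u i"
    "\<And>i. i \<in> I \<Longrightarrow> (\<Sum>j\<in>I. P i j * u j) \<le> (c + \<epsilon>) * u i"
proof -
  define q where "q = c / (c + \<epsilon>)"
  have q: "0 \<le> q" "q < 1" using assms by (auto simp: q_def)
  \<comment> \<open>\<open>x s\<close> is the all-ones vector after \<open>s\<close> applications of
    \<open>P\<close> divided by \<open>c + \<epsilon>\<close>; its total mass decays like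
    \<open>q ^ s\<close>.\<close>
  define x where "x = rec_nat (\<lambda>_. 1) (\<lambda>_ v i. (\<Sum>j\<in>I. P i j * v j) / (c + \<epsilon>))"
  have x0: "x 0 i = 1" and xS: "x (Suc s) i = (\<Sum>j\<in>I. P i j * x s j) / (c + \<epsilon>)" for s i
    by (simp_all add: x_def)
  have xpos: "0 \<le> x s i" if "i \<in> I" for s i
    using that assms by (induction s arbitrary: i) (auto simp: x0 xS intro!: divide_nonneg_pos sum_nonneg)
  have xsum: "(\<Sum>i\<in>I. x s i) \<le> real (card I) * q ^ s" for s
  proof (induction s)
    case 0 then show ?case by (simp add: x0)
  next
    case (Suc s)
    have "(\<Sum>i\<in>I. x (Suc s) i) = (\<Sum>j\<in>I. (\<Sum>i\<in>I. P i j) * x s j) / (c + \<epsilon>)"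
      unfolding xS sum_divide_distrib[symmetric] by (subst sum.swap) (simp add: sum_distrib_right)
    also have "\<dots> \<le> (\<Sum>j\<in>I. c * x s j) / (c + \<epsilon>)"
      using assms col xpos by (intro divide_right_mono sum_mono mult_right_mono) auto
    also have "\<dots> = q * (\<Sum>j\<in>I. x s j)" by (simp add: q_def sum_distrib_left[symmetric])
    also have "\<dots> \<le> q * (real (card I) * q ^ s)" using Suc q by (intro mult_left_mono) auto
    finally show ?case by (simp add: mult_ac)
  qed
  have "(\<lambda>s. real (card I) * q ^ s) \<longlonglongrightarrow> real (card I) * 0"
    by (intro tendsto_intros LIMSEQ_realpow_zero q)
  then have "\<forall>\<^sub>F s in sequentially. real (card I) * q ^ s < 1"
    by (rule order_tendstoD(2)) simp
  then obtain S where S: "\<And>s. s \<ge> S \<Longrightarrow> real (card I) * q ^ s < 1"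
    unfolding eventually_sequentially by blast
  define u where "u i = (\<Sum>s\<le>S. x s i)" for i
  have u_split: "u i = 1 + (\<Sum>s<S. x (Suc s) i)" for i
    unfolding u_def by (simp add: lessThan_Suc_atMost[symmetric] sum.lessThan_Suc_shift x0 del: sum.lessThan_Suc)
  show thesis
  proof
    fix i assume i: "i \<in> I"
    have "0 \<le> (\<Sum>s<S. x (Suc s) i)" using xpos i by (intro sum_nonneg) auto
    then show "0 < u i" by (simp add: u_split)
    have "x (Suc S) i \<le> (\<Sum>i\<in>I. x (Suc S) i)"
      using i assms xpos by (intro member_le_sum) auto
    then have le1: "x (Suc S) i \<le> 1" using xsum[of "Suc S"] S[of "Suc S"] by simp
    have "(\<Sum>j\<in>I. P i j * u j) = (\<Sum>s\<le>S. \<Sum>j\<in>I. P i j * x s j)"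
      unfolding u_def sum_distrib_left by (rule sum.swap)
    also have "\<dots> = (c + \<epsilon>) * (\<Sum>s\<le>S. x (Suc s) i)"
      unfolding xS sum_divide_distrib[symmetric] using assms by simp
    also have "(\<Sum>s\<le>S. x (Suc s) i) = u i - 1 + x (Suc S) i"
      by (simp add: u_split lessThan_Suc_atMost[symmetric])
    also have "(c + \<epsilon>) * (u i - 1 + x (Suc S) i) \<le> (c + \<epsilon>) * u i"
      using le1 assms by (intro mult_left_mono) auto
    finally show "(\<Sum>j\<in>I. P i j * u j) \<le> (c + \<epsilon>) * u i" .
  qed
qed

locale bipartite_weights =
  fixes a b :: nat and N :: "nat \<Rightarrow> nat \<Rightarrow> real"
  assumes N_nonneg: "0 \<le> N i j" and N_le_1: "N i j \<le> 1"
begin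

definition rsum :: "nat \<Rightarrow> real" where "rsum i = (\<Sum>j<b. N i j)"
definition csum :: "nat \<Rightarrow> real" where "csum j = (\<Sum>i<a. N i j)"

lemma csum_nonneg: "0 \<le> csum j"
  by (auto simp: csum_def intro!: sum_nonneg N_nonneg)

lemma rsum_le: "rsum i \<le> b"
  using sum_bounded_above[of "{..<b}" "N i" 1] N_le_1 by (simp add: rsum_def)

text \<open>In matrix form J - N + Z N^T Z + Z D_B + (b - D_A) Z, so that the Riccati equation reads
  (a + b) Z = \<open>ric_num Z\<close>.\<close>

definition ric_num :: "(nat \<Rightarrow> nat \<Rightarrow> real) \<Rightarrow> nat \<Rightarrow> nat \<Rightarrow> real" where
  "ric_num Z i j = 1 - N i j + (\<Sum>l<b. Z i l * (\<Sum>p<a. N p l * Z p j)) + (b - rsum i + csum j) * Z i j"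

text \<open>Fixed points for \<open>\<epsilon> = 0\<close> are the solutions of the Riccati equation. Adding \<open>b - rsum i + csum j\<close> on both
  sides makes the iteration monotone and keeps the column sums below \<open>1\<close>; \<open>\<epsilon>\<close> makes the associated M-matrix
  nonsingular.\<close>

fun ric :: "real \<Rightarrow> nat \<Rightarrow> nat \<Rightarrow> nat \<Rightarrow> real" where
  "ric \<epsilon> 0 = (\<lambda>i j. 0)"
| "ric \<epsilon> (Suc t) = (\<lambda>i j. ric_num (ric \<epsilon> t) i j / (real a + real b + 2 * \<epsilon>))"

text \<open>All coefficients are nonnegative, since a row sum of \<open>N\<close> is at most
  \<open>b\<close>.\<close>

lemma ric_num_mono:
  assumes "\<And>i j. 0 \<le> Y i j" "\<And>i j. Y i j \<le> Z i j"
  shows "ric_num Y i j \<le> ric_num Z i j"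
proof -
  have Z: "\<And>i j. 0 \<le> Z i j" using assms order_trans by blast
  have *: "0 \<le> b - rsum i + csum j" using rsum_le[of i] csum_nonneg[of j] by simp
  show ?thesis
    unfolding ric_num_def
    by (intro add_mono order_refl sum_mono mult_mono mult_left_mono sum_nonneg mult_nonneg_nonneg N_nonneg assms Z *)
qed

lemma ric_num_nonneg: "(\<And>i j. 0 \<le> Z i j) \<Longrightarrow> 0 \<le> ric_num Z i j"
proof -
  assume Z: "\<And>i j. 0 \<le> Z i j"
  have *: "0 \<le> b - rsum i + csum j" using rsum_le[of i] csum_nonneg[of j] by simp
  show ?thesis
    unfolding ric_num_def
    by (intro add_nonneg_nonneg sum_nonneg mult_nonneg_nonneg N_nonneg Z *) (simp add: N_le_1)
qed

lemma ric_nonneg: "0 \<le> \<epsilon> \<Longrightarrow> 0 \<le> ric \<epsilon> t i j"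
  by (induction t arbitrary: i j) (auto intro!: divide_nonneg_nonneg ric_num_nonneg)

lemma ric_le_Suc: "0 \<le> \<epsilon> \<Longrightarrow> ric \<epsilon> t i j \<le> ric \<epsilon> (Suc t) i j"
proof (induction t arbitrary: i j)
  case 0 then show ?case using ric_nonneg[of \<epsilon> "Suc 0"] by simp
next
  case (Suc t)
  show ?case
    unfolding ric.simps(2)[of _ t] ric.simps(2)[of _ "Suc t"]
    by (intro divide_right_mono ric_num_mono Suc ric_nonneg) (use Suc in auto)
qed

text \<open>Summed over \<open>i\<close>, the quadratic term is bounded by the induction hypothesis
  for all columns \<open>l\<close>, and this bound cancels against the contribution of
  \<open>- rsum i\<close>. What remains is at most \<open>a + b\<close>.\<close>

lemma ric_col_sum: "(\<Sum>i<a. ric 0 t i j) \<le> 1"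
proof (induction t arbitrary: j)
  case 0 then show ?case by simp
next
  case (Suc t)
  let ?Z = "ric 0 t" let ?s = "\<lambda>j. \<Sum>i<a. ?Z i j"
  have "(\<Sum>l<b. \<Sum>i<a. ?Z i l * (\<Sum>p<a. N p l * ?Z p j)) = (\<Sum>l<b. ?s l * (\<Sum>p<a. N p l * ?Z p j))"
    by (simp add: sum_distrib_right)
  also have "\<dots> \<le> (\<Sum>l<b. 1 * (\<Sum>p<a. N p l * ?Z p j))"
    by (intro sum_mono mult_right_mono Suc sum_nonneg mult_nonneg_nonneg N_nonneg ric_nonneg) auto
  also have "\<dots> = (\<Sum>p<a. rsum p * ?Z p j)"
    by (simp add: rsum_def sum_distrib_right) (rule sum.swap)
  finally have 1: "(\<Sum>i<a. \<Sum>l<b. ?Z i l * (\<Sum>p<a. N p l * ?Z p j)) \<le> (\<Sum>p<a. rsum p * ?Z p j)"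
    by (subst sum.swap)
  have "(\<Sum>i<a. ric_num ?Z i j) = a - csum j + (\<Sum>i<a. \<Sum>l<b. ?Z i l * (\<Sum>p<a. N p l * ?Z p j))
      + (b * ?s j - (\<Sum>p<a. rsum p * ?Z p j) + csum j * ?s j)"
    by (simp add: ric_num_def sum.distrib sum_subtractf csum_def[symmetric] sum_distrib_left algebra_simps)
  also have "\<dots> \<le> a - csum j + (b * ?s j + csum j * ?s j)" using 1 by simp
  also have "\<dots> \<le> a - csum j + (real b * 1 + csum j * 1)"
    by (intro add_left_mono add_mono mult_left_mono Suc.IH csum_nonneg of_nat_0_le_iff)
  finally have "(\<Sum>i<a. ric_num ?Z i j) \<le> real a + real b" by simp
  then show ?case
    by (auto simp: sum_divide_distrib[symmetric] divide_le_eq_1 add_nonneg_eq_0_iff)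
qed

text \<open>The limit of the increasing iteration from zero. The bound on the eigenvalues of
  \<open>Rmat\<close> rests on this approximation from below.\<close>

definition Z :: "nat \<Rightarrow> nat \<Rightarrow> real" where "Z i j = lim (\<lambda>t. ric 0 t i j)"

lemma ric_tendsto_Z:
  assumes "i < a" shows "(\<lambda>t. ric 0 t i j) \<longlonglongrightarrow> Z i j"
proof -
  have "ric 0 t i j \<le> 1" for t
  proof -
    have "ric 0 t i j \<le> (\<Sum>i<a. ric 0 t i j)"
      using assms by (intro member_le_sum) (auto intro: ric_nonneg)
    then show ?thesis using ric_col_sum[of t j] by simp
  qed
  moreover have "incseq (\<lambda>t. ric 0 t i j)" by (rule incseq_SucI) (rule ric_le_Suc, simp)
  ultimately have "convergent (\<lambda>t. ric 0 t i j)"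
    by (metis incseq_convergent convergent_def)
  then show ?thesis by (simp add: Z_def convergent_LIMSEQ_iff)
qed

lemma Z_nonneg: "i < a \<Longrightarrow> 0 \<le> Z i j"
  by (rule LIMSEQ_le_const[OF ric_tendsto_Z]) (auto intro: ric_nonneg)

lemma Z_col_sum: "(\<Sum>i<a. Z i j) \<le> 1"
  by (rule LIMSEQ_le_const2[OF tendsto_sum[OF ric_tendsto_Z]]) (auto intro: ric_col_sum)

text \<open>The recursion passes to the limit. The last factor is the entry \<open>(l, j)\<close> of
  \<open>Rmat\<close>, the form required for the block triangularization.\<close>

lemma Z_riccati:
  assumes "i < a" and that: "j < b"
  shows "(rsum i + a) * Z i j = 1 - N i j + (\<Sum>l<b. Z i l * ((\<Sum>p<a. N p l * Z p j) + (if l = j then csum j else 0)))"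
proof -
  have "(\<lambda>t. ric 0 (Suc t) i j) \<longlonglongrightarrow> ric_num Z i j / (real a + real b + 2 * 0)"
    unfolding ric.simps ric_num_def
    using assms
    by (intro tendsto_add tendsto_sum tendsto_mult tendsto_divide tendsto_const ric_tendsto_Z) auto
  moreover have "(\<lambda>t. ric 0 (Suc t) i j) \<longlonglongrightarrow> Z i j"
    by (rule LIMSEQ_Suc[OF ric_tendsto_Z[OF assms(1)]])
  ultimately have "Z i j = ric_num Z i j / (real a + real b)" by (auto dest: LIMSEQ_unique)
  then have "(real a + real b) * Z i j = ric_num Z i j" using assms by (simp add: field_simps)
  moreover have "(\<Sum>l<b. Z i l * (if l = j then csum j else 0)) = csum j * Z i j"
    using that by (simp add: if_distrib sum.delta cong: if_cong)
  ultimately show ?thesis by (simp add: ric_num_def algebra_simps sum.distrib)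
qed

text \<open>For fixed \<open>t\<close> the iterate is continuous in \<open>\<epsilon>\<close>, which
  transfers strict estimates from \<open>0\<close> to small positive
  \<open>\<epsilon>\<close>.\<close>

lemma ric_tendsto_0:
  assumes "0 < a + b"
  shows "((\<lambda>\<epsilon>. ric \<epsilon> t i j) \<longlongrightarrow> ric 0 t i j) (at_right 0)"
proof (induction t arbitrary: i j)
  case (Suc t)
  show ?case
    unfolding ric.simps ric_num_def
    using assms
    by (intro tendsto_add tendsto_sum tendsto_mult tendsto_divide tendsto_const tendsto_ident_at Suc) auto
qed simp

text \<open>A positive vector \<open>(v, w)\<close> that is superinvariant for the perturbed M-matrix satisfies \<open>Z v \<le> w\<close> along the
  iteration, so \<open>v\<close> bounds the spectral radius of \<open>R\<close>.\<close>

lemma ric_no_growth: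
  fixes \<epsilon> x :: real
  assumes "0 < \<epsilon>" "a + \<epsilon> < x"
    and y: "\<And>j. j < b \<Longrightarrow> 0 \<le> y j" and "j0 < b" "0 < y j0"
    and grow: "\<And>j. j < b \<Longrightarrow> x * y j \<le> csum j * y j + (\<Sum>l<b. (\<Sum>i<a. N i j * ric \<epsilon> t i l) * y l)"
  shows False
proof -
  define c where "c = real a + real b"
  \<comment> \<open>\<open>P\<close> is \<open>c\<close> times the identity minus the block matrix
    with rows (D_A, N - J) and (-N^T, a - D_B). That matrix has zero column sums, so every column of
    \<open>P\<close> sums to \<open>c\<close>.\<close>
  define P :: "nat + nat \<Rightarrow> nat + nat \<Rightarrow> real" where
    "P = (\<lambda>s s'. case s of
        Inl i \<Rightarrow> (case s' of Inl p \<Rightarrow> (if i = p then c - rsum i else 0) | Inr j \<Rightarrow> 1 - N i j)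
      | Inr j \<Rightarrow> (case s' of Inl i \<Rightarrow> N i j | Inr l \<Rightarrow> (if j = l then c - a + csum j else 0)))"
  let ?I = "{..<a} <+> {..<b}"
  have sum_I: "(\<Sum>s\<in>?I. f s) = (\<Sum>i<a. f (Inl i)) + (\<Sum>j<b. f (Inr j))" for f :: "nat + nat \<Rightarrow> real"
    by (simp add: sum.Plus comp_def)
  obtain u where u: "\<And>s. s \<in> ?I \<Longrightarrow> 0 < u s"
    and Pu: "\<And>s. s \<in> ?I \<Longrightarrow> (\<Sum>s'\<in>?I. P s s' * u s') \<le> (c + \<epsilon>) * u s"
  proof (rule ex_pos_superinvariant[of ?I P c \<epsilon>])
    show "0 \<le> P s s'" for s s'
      using rsum_le csum_nonneg N_nonneg N_le_1
      by (auto simp: P_def c_def split: sum.splits) (smt (verit) rsum_le of_nat_0_le_iff)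
    show "(\<Sum>s\<in>?I. P s s') \<le> c" if "s' \<in> ?I" for s'
      using that by (auto simp: sum_I P_def sum_subtractf csum_def[symmetric] rsum_def[symmetric])
  qed (use assms in \<open>auto simp: c_def\<close>)
  define v where "v j = u (Inr j)" for j
  define w where "w i = u (Inl i)" for i
  have v: "0 < v j" if "j < b" for j using u that by (auto simp: v_def)
  have w: "0 < w i" if "i < a" for i using u that by (auto simp: w_def)
  have Kw: "(\<Sum>j<b. (1 - N i j) * v j) \<le> (rsum i + \<epsilon>) * w i" if "i < a" for i
    using Pu[OF InlI, of i] that
    by (simp add: sum_I P_def v_def w_def if_distrib if_distribR sum.delta' algebra_simps cong: if_cong)
  have Kv: "(\<Sum>i<a. N i j * w i) \<le> (a - csum j + \<epsilon>) * v j" if "j < b" for j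
    using Pu[OF InrI, of j] that
    by (simp add: sum_I P_def v_def w_def if_distrib if_distribR sum.delta' algebra_simps cong: if_cong)
  have inv: "(\<Sum>j<b. ric \<epsilon> t i j * v j) \<le> w i" if "i < a" for i t
    using that
  proof (induction t arbitrary: i)
    case 0 then show ?case using w by (simp add: less_imp_le)
  next
    case (Suc t)
    let ?Z = "ric \<epsilon> t"
    have Z: "0 \<le> ?Z i j" for i j using assms by (intro ric_nonneg) simp
    have "(\<Sum>j<b. (\<Sum>l<b. ?Z i l * (\<Sum>p<a. N p l * ?Z p j)) * v j)
        = (\<Sum>l<b. ?Z i l * (\<Sum>p<a. N p l * (\<Sum>j<b. ?Z p j * v j)))"
    proof -
      have "(\<Sum>j<b. (\<Sum>l<b. ?Z i l * (\<Sum>p<a. N p l * ?Z p j)) * v j)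
          = (\<Sum>j<b. \<Sum>l<b. \<Sum>p<a. ?Z i l * N p l * ?Z p j * v j)"
        by (simp add: sum_distrib_left sum_distrib_right mult_ac)
      also have "\<dots> = (\<Sum>l<b. \<Sum>p<a. \<Sum>j<b. ?Z i l * N p l * ?Z p j * v j)"
        by (subst sum.swap) (intro sum.cong refl sum.swap)
      finally show ?thesis by (simp add: sum_distrib_left mult_ac)
    qed
    also have "\<dots> \<le> (\<Sum>l<b. ?Z i l * (\<Sum>p<a. N p l * w p))"
      by (intro sum_mono mult_left_mono Suc Z N_nonneg) auto
    also have "\<dots> \<le> (\<Sum>l<b. ?Z i l * ((a - csum l + \<epsilon>) * v l))"
      by (intro sum_mono mult_left_mono Kv Z) auto
    finally have quad: "(\<Sum>j<b. (\<Sum>l<b. ?Z i l * (\<Sum>p<a. N p l * ?Z p j)) * v j)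
        \<le> (\<Sum>l<b. ?Z i l * ((a - csum l + \<epsilon>) * v l))" .
    have "(\<Sum>j<b. ric_num ?Z i j * v j) =
        (\<Sum>j<b. (1 - N i j) * v j) + (\<Sum>j<b. (\<Sum>l<b. ?Z i l * (\<Sum>p<a. N p l * ?Z p j)) * v j)
        + (\<Sum>j<b. (b - rsum i + csum j) * ?Z i j * v j)"
      by (simp add: ric_num_def sum.distrib[symmetric] algebra_simps)
    also have "\<dots> \<le> (rsum i + \<epsilon>) * w i + (\<Sum>l<b. ?Z i l * ((a - csum l + \<epsilon>) * v l))
        + (\<Sum>j<b. (b - rsum i + csum j) * ?Z i j * v j)"
      using Kw[OF Suc.prems] quad by simp
    also have "\<dots> = (rsum i + \<epsilon>) * w i + (a + \<epsilon> + b - rsum i) * (\<Sum>j<b. ?Z i j * v j)"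
      unfolding sum_distrib_left add.assoc sum.distrib[symmetric] by (simp add: algebra_simps)
    also have "\<dots> \<le> (rsum i + \<epsilon>) * w i + (a + \<epsilon> + b - rsum i) * w i"
      using rsum_le[of i] assms by (intro add_left_mono mult_left_mono Suc) auto
    \<comment> \<open>One \<open>\<epsilon>\<close> stems from \<open>Kw\<close> and one from
      \<open>Kv\<close>; the denominator of \<open>ric\<close> contains
      \<open>2 * \<epsilon>\<close> to absorb both.\<close>
    also have "\<dots> = (real a + real b + 2 * \<epsilon>) * w i" by (simp add: algebra_simps)
    finally have "(\<Sum>j<b. ric_num ?Z i j * v j) \<le> (real a + real b + 2 * \<epsilon>) * w i" .
    then show ?case using assms
      by (simp add: sum_divide_distrib[symmetric] divide_le_eq mult.commute add_nonneg_pos)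
  qed
  have Rv: "csum j * v j + (\<Sum>l<b. (\<Sum>i<a. N i j * ric \<epsilon> t i l) * v l) \<le> (a + \<epsilon>) * v j" if "j < b" for j
  proof -
    have "(\<Sum>l<b. (\<Sum>i<a. N i j * ric \<epsilon> t i l) * v l) = (\<Sum>i<a. N i j * (\<Sum>l<b. ric \<epsilon> t i l * v l))"
      by (simp add: sum_distrib_left sum_distrib_right mult_ac) (rule sum.swap)
    also have "\<dots> \<le> (\<Sum>i<a. N i j * w i)" by (intro sum_mono mult_left_mono inv N_nonneg) auto
    finally show ?thesis using Kv[OF that] by (simp add: algebra_simps)
  qed
  \<comment> \<open>Collatz-Wielandt comparison: \<open>m\<close> is the largest ratio of
    \<open>y\<close> to the superinvariant vector \<open>v\<close>, and an index attaining it
    contradicts growth by \<open>x > a + \<epsilon>\<close>.\<close>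
  define m where "m = Max ((\<lambda>j. y j / v j) ` {..<b})"
  have "m \<in> (\<lambda>j. y j / v j) ` {..<b}" unfolding m_def using \<open>j0 < b\<close> by (intro Max_in) auto
  then obtain j where j: "j < b" "y j = m * v j" using v by force
  have mle: "y l \<le> m * v l" if "l < b" for l
  proof -
    have "y l / v l \<le> m" unfolding m_def using that by (intro Max_ge) auto
    then show ?thesis using v[OF that] by (simp add: field_simps)
  qed
  have mpos: "0 < m"
  proof (rule ccontr)
    assume "\<not> 0 < m"
    then have "m * v j0 \<le> 0" using v[OF \<open>j0 < b\<close>] by (simp add: mult_nonpos_nonneg)
    then show False using mle[OF \<open>j0 < b\<close>] \<open>0 < y j0\<close> by simp
  qed
  have "x * y j \<le> csum j * y j + (\<Sum>l<b. (\<Sum>i<a. N i j * ric \<epsilon> t i l) * y l)" by (rule grow[OF j(1)])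
  also have "\<dots> \<le> csum j * (m * v j) + (\<Sum>l<b. (\<Sum>i<a. N i j * ric \<epsilon> t i l) * (m * v l))"
    using assms unfolding j(2)
    by (intro add_mono order_refl sum_mono mult_left_mono mle sum_nonneg mult_nonneg_nonneg N_nonneg ric_nonneg) auto
  also have "\<dots> = m * (csum j * v j + (\<Sum>l<b. (\<Sum>i<a. N i j * ric \<epsilon> t i l) * v l))"
    by (simp add: algebra_simps sum_distrib_left)
  also have "\<dots> \<le> m * ((a + \<epsilon>) * v j)" using mpos by (intro mult_left_mono Rv j) auto
  also have "\<dots> < m * (x * v j)" using mpos v[OF j(1)] assms by (intro mult_strict_left_mono mult_strict_right_mono) auto
  finally show False using j by (simp add: mult_ac)
qed

text \<open>The gap between \<open>a\<close> and \<open>x\<close> is spent in stages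
  \<open>a < x2 < x1 < x\<close>: first \<open>Z\<close> is replaced by an iterate, then
  \<open>\<epsilon> = 0\<close> by a small positive \<open>\<epsilon>\<close>, where
  \<open>ric_no_growth\<close> applies.\<close>

lemma Z_no_growth:
  fixes x :: real
  assumes "a < x" and y: "\<And>j. j < b \<Longrightarrow> 0 \<le> y j" and j0: "j0 < b" "0 < y j0"
    and grow: "\<And>j. j < b \<Longrightarrow> x * y j \<le> csum j * y j + (\<Sum>l<b. (\<Sum>i<a. N i j * Z i l) * y l)"
  shows False
proof -
  define g where "g \<epsilon> t j = csum j * y j + (\<Sum>l<b. (\<Sum>i<a. N i j * ric \<epsilon> t i l) * y l)" for \<epsilon> t j
  have g_nonneg: "0 \<le> g \<epsilon> t j" if "j < b" "0 \<le> \<epsilon>" for \<epsilon> t j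
    unfolding g_def using that y csum_nonneg
    by (intro add_nonneg_nonneg sum_nonneg mult_nonneg_nonneg N_nonneg ric_nonneg) auto
  obtain x1 where x1: "real a < x1" "x1 < x" using dense[OF assms(1)] by blast
  obtain x2 where x2: "real a < x2" "x2 < x1" using dense[OF x1(1)] by blast
  have "\<forall>\<^sub>F t in sequentially. \<forall>j\<in>{..<b}. x1 * y j \<le> g 0 t j"
  proof (intro eventually_ball_finite ballI)
    fix j assume j: "j \<in> {..<b}"
    show "\<forall>\<^sub>F t in sequentially. x1 * y j \<le> g 0 t j"
    \<comment> \<open>Where \<open>y j\<close> vanishes no strict inequality is available, but
      nonnegativity of \<open>g\<close> suffices.\<close>
    proof (cases "y j = 0")
      case True then show ?thesis using g_nonneg j by auto
    next
      case False
      have "(\<lambda>t. g 0 t j) \<longlonglongrightarrow> csum j * y j + (\<Sum>l<b. (\<Sum>i<a. N i j * Z i l) * y l)"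
        unfolding g_def by (intro tendsto_add tendsto_sum tendsto_mult tendsto_const ric_tendsto_Z) auto
      moreover have "x1 * y j < csum j * y j + (\<Sum>l<b. (\<Sum>i<a. N i j * Z i l) * y l)"
      proof -
        have "x1 * y j < x * y j" using False y[of j] j x1 by (intro mult_strict_right_mono) auto
        also have "\<dots> \<le> csum j * y j + (\<Sum>l<b. (\<Sum>i<a. N i j * Z i l) * y l)" using grow j by simp
        finally show ?thesis .
      qed
      ultimately have "\<forall>\<^sub>F t in sequentially. x1 * y j < g 0 t j" by (rule order_tendstoD)
      then show ?thesis by (rule eventually_mono) simp
    qed
  qed simp
  then obtain t where t: "\<And>j. j < b \<Longrightarrow> x1 * y j \<le> g 0 t j"
    by (auto simp: eventually_sequentially)
  have "\<forall>\<^sub>F \<epsilon> in at_right 0. \<forall>j\<in>{..<b}. x2 * y j \<le> g \<epsilon> t j"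
  proof (intro eventually_ball_finite ballI)
    fix j assume j: "j \<in> {..<b}"
    show "\<forall>\<^sub>F \<epsilon> in at_right 0. x2 * y j \<le> g \<epsilon> t j"
    proof (cases "y j = 0")
      case True
      have "\<forall>\<^sub>F \<epsilon> in at_right (0::real). 0 < \<epsilon>" by (simp add: eventually_at_right_less)
      then show ?thesis by (rule eventually_mono) (use True g_nonneg j in auto)
    next
      case False
      have "((\<lambda>\<epsilon>. g \<epsilon> t j) \<longlongrightarrow> g 0 t j) (at_right 0)"
        unfolding g_def using j0 by (intro tendsto_add tendsto_sum tendsto_mult tendsto_const ric_tendsto_0) auto
      moreover have "x2 * y j < g 0 t j"
      proof -
        have "x2 * y j < x1 * y j" using False y[of j] j x2 by (intro mult_strict_right_mono) auto
        also have "\<dots> \<le> g 0 t j" using t j by simp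
        finally show ?thesis .
      qed
      ultimately have "\<forall>\<^sub>F \<epsilon> in at_right 0. x2 * y j < g \<epsilon> t j" by (rule order_tendstoD)
      then show ?thesis by (rule eventually_mono) simp
    qed
  qed simp
  moreover have "\<forall>\<^sub>F \<epsilon> in at_right 0. 0 < \<epsilon> \<and> \<epsilon> < x2 - a"
    unfolding eventually_at_right_field using x2 by (intro exI[of _ "x2 - a"]) auto
  ultimately have "\<forall>\<^sub>F \<epsilon> in at_right 0. (0 < \<epsilon> \<and> \<epsilon> < x2 - a) \<and> (\<forall>j\<in>{..<b}. x2 * y j \<le> g \<epsilon> t j)"
    by eventually_elim blast
  then obtain \<epsilon> where "0 < \<epsilon>" "\<epsilon> < x2 - a" "\<And>j. j < b \<Longrightarrow> x2 * y j \<le> g \<epsilon> t j"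
    by (auto dest!: eventually_happens simp: trivial_limit_at_right_real)
  then show False
    using ric_no_growth[of \<epsilon> x2 y j0 t] y j0 by (auto simp: g_def)
qed

end

section \<open>Split graphs\<close>

lemma sum_lessThan_add:
  fixes f :: "nat \<Rightarrow> 'a :: comm_monoid_add"
  shows "(\<Sum>i<a + b. f i) = (\<Sum>i<a. f i) + (\<Sum>j<b. f (a + j))"
  by (induction b) (auto simp: add.assoc)

section \<open>Block triangular form and location of the eigenvalues\<close>

context bipartite_weights
begin

text \<open>The Laplacian of the split graph with the clique listed first: a clique node has degree
  \<open>rsum i + a - 1\<close>, and the \<open>- 1\<close> is shared by all entries of the clique
  block.\<close>

definition Lmat :: "real mat" where
  "Lmat = four_block_mat (mat a a (\<lambda>(i, p). (if i = p then rsum i + a else 0) - 1))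
     (mat a b (\<lambda>(i, j). - N i j)) (mat b a (\<lambda>(j, i). - N i j)) (mat b b (\<lambda>(j, l). if j = l then csum j else 0))"

text \<open>\<open>Mmat\<close> adds \<open>1\<close> to every entry of the first \<open>a\<close> rows of \<open>Lmat\<close>, which makes all column sums equal to \<open>a\<close>.\<close>

definition Mmat :: "real mat" where
  "Mmat = four_block_mat (mat a a (\<lambda>(i, p). if i = p then rsum i + a else 0))
     (mat a b (\<lambda>(i, j). 1 - N i j)) (mat b a (\<lambda>(j, i). - N i j)) (mat b b (\<lambda>(j, l). if j = l then csum j else 0))"

definition Qmat :: "real mat" where
  "Qmat = mat a a (\<lambda>(i, p). (if i = p then rsum i + a else 0) - (\<Sum>l<b. Z i l * N p l))"

definition Rmat :: "real mat" where
  "Rmat = mat b b (\<lambda>(l, j). (\<Sum>p<a. N p l * Z p j) + (if l = j then csum j else 0))"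

lemma carriers: "Lmat \<in> carrier_mat (a + b) (a + b)" "Mmat \<in> carrier_mat (a + b) (a + b)"
  "Qmat \<in> carrier_mat a a" "Rmat \<in> carrier_mat b b"
  by (auto simp: Lmat_def Mmat_def Qmat_def Rmat_def)

lemma char_poly_Lmat: "char_poly Lmat * [:- real a, 1:] = char_poly Mmat * [:0, 1:]"
proof (rule char_poly_rank_one_update[OF carriers(1,2), where g = "\<lambda>i. of_bool (i < a)"])
  show "Mmat $$ (i, j) = Lmat $$ (i, j) + of_bool (i < a)" if "i < a + b" "j < a + b" for i j
    using that by (auto simp: Mmat_def Lmat_def)
  show "(\<Sum>i<a + b. of_bool (i < a)) = real a" unfolding sum_lessThan_add by simp
  show "(\<Sum>i<a + b. Mmat $$ (i, j)) = real a" if j: "j < a + b" for j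
  proof (cases "j < a")
    case True
    then show ?thesis
      unfolding sum_lessThan_add by (simp add: Mmat_def rsum_def[symmetric] sum_negf)
  next
    case False
    then have "j - a < b" using j by simp
    then show ?thesis using False
      unfolding sum_lessThan_add by (simp add: Mmat_def csum_def[symmetric] sum_subtractf)
  qed
qed

text \<open>Conjugation by the unipotent block matrix with corner \<open>- ZM\<close>; the upper
  right block of the result vanishes precisely by the Riccati equation, equation \<open>2\<close>
  below.\<close>

lemma char_poly_Mmat: "char_poly Mmat = char_poly Qmat * char_poly Rmat"
proof -
  define ZM where "ZM = mat a b (\<lambda>(i, j). Z i j)"
  define NT where "NT = mat b a (\<lambda>(j, i). - N i j)"
  have ZM: "ZM \<in> carrier_mat a b" and NT: "NT \<in> carrier_mat b a" by (auto simp: ZM_def NT_def)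
  let ?M11 = "mat a a (\<lambda>(i, p). if i = p then rsum i + a else 0)"
  let ?M12 = "mat a b (\<lambda>(i, j). 1 - N i j)"
  let ?M22 = "mat b b (\<lambda>(j, l). if j = l then csum j else 0)"
  let ?P = "four_block_mat (1\<^sub>m a) (- ZM) (0\<^sub>m b a) (1\<^sub>m b)"
  let ?P' = "four_block_mat (1\<^sub>m a) ZM (0\<^sub>m b a) (1\<^sub>m b)"
  let ?V = "four_block_mat Qmat (0\<^sub>m a b) NT Rmat"
  have M: "Mmat = four_block_mat ?M11 ?M12 NT ?M22" by (simp add: Mmat_def NT_def)
  have "char_poly Mmat = char_poly ?V"
  proof (rule char_poly_eq_if_intertwined[of _ "a + b" _ ?P ?P'])
    have ZZ: "ZM + - ZM = 0\<^sub>m a b" "- ZM + ZM = 0\<^sub>m a b" by (rule eq_matI; auto simp: ZM_def)+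
    have zero: "- 0\<^sub>m b b + 1\<^sub>m b = (1\<^sub>m b :: real mat)" by (rule eq_matI) auto
    show "?P * ?P' = 1\<^sub>m (a + b)"
      using ZM by (subst mult_four_block_mat[of _ a a _ b _ b _ _ a _ b]) (auto simp: ZZ zero)
    show "?P' * ?P = 1\<^sub>m (a + b)"
      using ZM by (subst mult_four_block_mat[of _ a a _ b _ b _ _ a _ b]) (auto simp: ZZ zero)
    have 1: "?M11 = Qmat + (- ZM) * NT"
      by (rule eq_matI) (auto simp: Qmat_def ZM_def NT_def scalar_prod_def lessThan_atLeast0 sum_negf)
    have 2: "?M11 * (- ZM) + ?M12 = (- ZM) * Rmat"
    proof (rule eq_matI)
      fix i j assume "i < dim_row ((- ZM) * Rmat)" "j < dim_col ((- ZM) * Rmat)"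
      then have ij: "i < a" "j < b" by (auto simp: ZM_def Rmat_def)
      have "(?M11 * (- ZM) + ?M12) $$ (i, j) = (\<Sum>p<a. (if i = p then rsum i + a else 0) * - Z p j) + (1 - N i j)"
        using ij by (simp add: ZM_def scalar_prod_def lessThan_atLeast0 sum_negf)
      also have "\<dots> = - ((rsum i + a) * Z i j) + (1 - N i j)"
        using ij by (simp add: if_distrib if_distribR cong: if_cong)
      also have "\<dots> = (\<Sum>l<b. - Z i l * ((\<Sum>p<a. N p l * Z p j) + (if l = j then csum j else 0)))"
        unfolding Z_riccati[OF ij] by (simp add: sum_negf)
      also have "\<dots> = ((- ZM) * Rmat) $$ (i, j)"
        using ij by (simp add: ZM_def Rmat_def scalar_prod_def lessThan_atLeast0 sum_negf)
      finally show "(?M11 * (- ZM) + ?M12) $$ (i, j) = ((- ZM) * Rmat) $$ (i, j)" .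
    qed (auto simp: ZM_def Rmat_def)
    have 3: "NT * (- ZM) + ?M22 = Rmat"
      by (rule eq_matI) (auto simp: Rmat_def ZM_def NT_def scalar_prod_def lessThan_atLeast0 sum_negf)
    have "Mmat * ?P = four_block_mat (?M11 * 1\<^sub>m a + ?M12 * 0\<^sub>m b a) (?M11 * (- ZM) + ?M12 * 1\<^sub>m b)
        (NT * 1\<^sub>m a + ?M22 * 0\<^sub>m b a) (NT * (- ZM) + ?M22 * 1\<^sub>m b)"
      unfolding M by (rule mult_four_block_mat) (use ZM NT in auto)
    also have "\<dots> = four_block_mat ?M11 (?M11 * (- ZM) + ?M12) NT (NT * (- ZM) + ?M22)"
      using NT ZM by (intro cong_four_block_mat) auto
    also have "\<dots> = four_block_mat (Qmat + (- ZM) * NT) ((- ZM) * Rmat) NT Rmat"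
      using 1 2 3 by simp
    also have "\<dots> = four_block_mat (1\<^sub>m a * Qmat + (- ZM) * NT) (1\<^sub>m a * 0\<^sub>m a b + (- ZM) * Rmat)
        (0\<^sub>m b a * Qmat + 1\<^sub>m b * NT) (0\<^sub>m b a * 0\<^sub>m a b + 1\<^sub>m b * Rmat)"
      using NT ZM carriers by (intro cong_four_block_mat) auto
    also have "\<dots> = ?P * ?V"
      by (rule mult_four_block_mat[symmetric]) (use ZM NT carriers in auto)
    finally show "Mmat * ?P = ?P * ?V" .
  qed (use carriers ZM NT in auto)
  then show ?thesis using char_poly_block_lower[OF carriers(3) NT carriers(4)] by simp
qed

text \<open>Gershgorin's argument for columns, hence the transpose: as the columns of
  \<open>Z\<close> sum to at most \<open>1\<close>, column \<open>p\<close> of Z N^T sums to at most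
  \<open>rsum p\<close>.\<close>

lemma Qmat_root_ge:
  fixes x :: real
  assumes "poly (char_poly Qmat) x = 0"
  shows "a \<le> x"
proof -
  have QT: "transpose_mat Qmat \<in> carrier_mat a a" using carriers by simp
  have "poly (char_poly (transpose_mat Qmat)) x = 0"
    using assms char_poly_transpose_mat[OF carriers(3)] by simp
  then obtain v :: "nat \<Rightarrow> real" where v0: "\<exists>i<a. v i \<noteq> 0"
    and v: "\<And>p. p < a \<Longrightarrow> (\<Sum>i<a. transpose_mat Qmat $$ (p, i) * v i) = x * v p"
    using ex_coord_eigenvector[OF QT] by metis
  obtain p where p: "p < a" "\<And>i. i < a \<Longrightarrow> \<bar>v i\<bar> \<le> \<bar>v p\<bar>"
    by (rule ex_max_coord[of a "\<lambda>i. \<bar>v i\<bar>"]) (use v0 in auto)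
  have "x * v p = (\<Sum>i<a. (if i = p then (rsum p + a) * v p else 0) - (\<Sum>l<b. Z i l * N p l) * v i)"
    unfolding v[OF p(1), symmetric] using p by (intro sum.cong refl) (auto simp: Qmat_def algebra_simps)
  also have "\<dots> = (rsum p + a) * v p - (\<Sum>i<a. (\<Sum>l<b. Z i l * N p l) * v i)"
    using p by (simp add: sum_subtractf)
  finally have eq: "(rsum p + a - x) * v p = (\<Sum>i<a. (\<Sum>l<b. Z i l * N p l) * v i)"
    by (simp add: algebra_simps)
  have "(rsum p + a - x) * \<bar>v p\<bar> \<le> \<bar>(rsum p + a - x) * v p\<bar>"
    by (simp add: abs_mult mult_right_mono)
  also have "\<dots> \<le> (\<Sum>i<a. \<bar>(\<Sum>l<b. Z i l * N p l) * v i\<bar>)"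
    unfolding eq by (rule sum_abs)
  also have "\<dots> \<le> (\<Sum>i<a. (\<Sum>l<b. Z i l * N p l) * \<bar>v p\<bar>)"
  proof (rule sum_mono)
    fix i assume i: "i \<in> {..<a}"
    have "0 \<le> (\<Sum>l<b. Z i l * N p l)" using i by (intro sum_nonneg mult_nonneg_nonneg Z_nonneg N_nonneg) auto
    then show "\<bar>(\<Sum>l<b. Z i l * N p l) * v i\<bar> \<le> (\<Sum>l<b. Z i l * N p l) * \<bar>v p\<bar>"
      using p(2)[of i] i by (simp add: abs_mult mult_left_mono)
  qed
  also have "\<dots> = (\<Sum>l<b. (\<Sum>i<a. Z i l) * N p l) * \<bar>v p\<bar>"
    unfolding sum_distrib_right[symmetric] by (subst sum.swap) (simp add: sum_distrib_right)
  also have "\<dots> \<le> (\<Sum>l<b. 1 * N p l) * \<bar>v p\<bar>"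
    by (intro mult_right_mono sum_mono Z_col_sum N_nonneg) auto
  also have "\<dots> = rsum p * \<bar>v p\<bar>" by (simp add: rsum_def)
  finally have "(rsum p + a - x) * \<bar>v p\<bar> \<le> rsum p * \<bar>v p\<bar>" .
  moreover have "0 < \<bar>v p\<bar>" using v0 p(2) by force
  ultimately show ?thesis by (simp add: mult_le_cancel_right)
qed

text \<open>\<open>Rmat\<close> has nonnegative entries, so for a root \<open>x > a\<close> the
  absolute values of an eigenvector would grow by the factor \<open>x\<close>, which
  \<open>Z_no_growth\<close> excludes.\<close>

lemma Rmat_root_le:
  fixes x :: real
  assumes "poly (char_poly Rmat) x = 0"
  shows "x \<le> a"
proof (rule ccontr)
  assume "\<not> x \<le> a"
  then have x: "a < x" by simp
  obtain v :: "nat \<Rightarrow> real" where v0: "\<exists>j<b. v j \<noteq> 0"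
    and v: "\<And>j. j < b \<Longrightarrow> (\<Sum>l<b. Rmat $$ (j, l) * v l) = x * v j"
    using ex_coord_eigenvector[OF carriers(4) assms] by metis
  obtain j0 where j0: "j0 < b" "v j0 \<noteq> 0" using v0 by blast
  show False
  proof (rule Z_no_growth[of x "\<lambda>j. \<bar>v j\<bar>" j0])
    fix j assume j: "j < b"
    have "x * \<bar>v j\<bar> = \<bar>\<Sum>l<b. Rmat $$ (j, l) * v l\<bar>" using v[OF j] x by (simp add: abs_mult)
    also have "\<dots> \<le> (\<Sum>l<b. Rmat $$ (j, l) * \<bar>v l\<bar>)"
    proof (rule order_trans[OF sum_abs], rule sum_mono)
      fix l assume l: "l \<in> {..<b}"
      have "0 \<le> Rmat $$ (j, l)"
        using j l by (auto simp: Rmat_def intro!: add_nonneg_nonneg sum_nonneg mult_nonneg_nonneg N_nonneg Z_nonneg csum_nonneg)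
      then show "\<bar>Rmat $$ (j, l) * v l\<bar> \<le> Rmat $$ (j, l) * \<bar>v l\<bar>" by (simp add: abs_mult)
    qed
    also have "\<dots> = (\<Sum>l<b. (if l = j then csum j * \<bar>v j\<bar> else 0) + (\<Sum>i<a. N i j * Z i l) * \<bar>v l\<bar>)"
      using j by (intro sum.cong refl) (auto simp: Rmat_def algebra_simps)
    also have "\<dots> = csum j * \<bar>v j\<bar> + (\<Sum>l<b. (\<Sum>i<a. N i j * Z i l) * \<bar>v l\<bar>)"
      using j by (simp add: sum.distrib)
    finally show "x * \<bar>v j\<bar> \<le> csum j * \<bar>v j\<bar> + (\<Sum>l<b. (\<Sum>i<a. N i j * Z i l) * \<bar>v l\<bar>)" .
  qed (use x j0 in auto)
qed

text \<open>The list \<open>ls\<close> with \<open>a\<close> added and the roots of both blocks with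
  \<open>0\<close> added agree as multisets. Neither \<open>a\<close> nor \<open>0\<close> has any
  excess over \<open>a\<close>, so only the \<open>a\<close> roots of \<open>Qmat\<close>
  count.\<close>

lemma sum_excess_le:
  fixes ls :: "real list"
  assumes "char_poly Lmat = lin_prod ls"
  shows "sum_list (map (\<lambda>l. max 0 (l - a)) ls) \<le> (\<Sum>i<a. rsum i)"
proof -
  have prod: "lin_prod (real a # ls) = [:0, 1:] * (char_poly Qmat * char_poly Rmat)"
    using char_poly_Lmat char_poly_Mmat assms by (simp only: list.map prod_list.Cons mult.commute)
  obtain qs where qs: "char_poly Qmat = lin_prod qs"
  proof -
    have "char_poly Qmat dvd lin_prod (real a # ls)" unfolding prod by (intro dvd_mult dvd_triv_left)
    then show thesis using dvd_lin_prod_imp_lin_prod[OF lead_coeff_char_poly[OF carriers(3)]] that by blast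
  qed
  obtain rs where rs: "char_poly Rmat = lin_prod rs"
  proof -
    have "char_poly Rmat dvd lin_prod (real a # ls)" unfolding prod by (intro dvd_mult dvd_triv_right)
    then show thesis using dvd_lin_prod_imp_lin_prod[OF lead_coeff_char_poly[OF carriers(4)]] that by blast
  qed
  have "lin_prod (real a # ls) = lin_prod (0 # qs @ rs)" unfolding prod qs rs by simp
  then have ms: "mset (real a # ls) = mset (0 # qs @ rs)" by (rule mset_eq_if_lin_prod_eq)
  let ?f = "\<lambda>l. max 0 (l - real a)"
  have q: "map ?f qs = map (\<lambda>l. l - a) qs"
  proof (intro map_cong refl)
    fix x assume "x \<in> set qs"
    then show "?f x = x - a" using Qmat_root_ge[of x] by (simp add: qs poly_lin_prod_eq_0_iff)
  qed
  have r: "map ?f rs = map (\<lambda>_. 0) rs"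
  proof (intro map_cong refl)
    fix x assume "x \<in> set rs"
    then show "?f x = 0" using Rmat_root_le[of x] by (simp add: rs poly_lin_prod_eq_0_iff)
  qed
  have len: "length qs = a"
    using degree_monic_char_poly[OF carriers(3)] degree_linear_factors[of uminus qs] by (simp add: qs)
  have "sum_list (map ?f ls) = sum_mset (image_mset ?f (mset (real a # ls)))"
    by (simp add: sum_mset_sum_list[symmetric])
  also have "\<dots> = sum_list (map ?f (0 # qs @ rs))"
    unfolding ms by (simp only: mset_map[symmetric] sum_mset_sum_list)
  also have "\<dots> = sum_list (map (\<lambda>l. l - a) qs) + sum_list (map (\<lambda>_. 0) rs)"
    by (simp only: list.map map_append q r sum_list.Cons sum_list_append)
  also have "\<dots> = sum_list qs - a * a" using len by (simp add: sum_list_subtractf sum_list_triv)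
  also have "sum_list qs = (\<Sum>i<a. Qmat $$ (i, i))" by (rule sum_list_eq_trace[OF carriers(3) qs])
  also have "\<dots> \<le> (\<Sum>i<a. rsum i + a)"
  proof (rule sum_mono)
    fix i assume i: "i \<in> {..<a}"
    then have "0 \<le> (\<Sum>l<b. Z i l * N i l)" by (intro sum_nonneg mult_nonneg_nonneg Z_nonneg N_nonneg) auto
    then show "Qmat $$ (i, i) \<le> rsum i + a" using i by (simp add: Qmat_def)
  qed
  finally show ?thesis by (simp add: sum.distrib)
qed

end

lemma split_graph_eig_sum_le:
  assumes E: "simple_graph {0..<n} E" and "split_graph {0..<n} E"
  shows "lap_eig_sum n E k \<le> card E + tri k"
proof -
  obtain A B where AB: "A \<union> B = {0..<n}" "A \<inter> B = {}"
    and "\<forall>u\<in>A. \<forall>v\<in>A. u \<noteq> v \<longrightarrow> {u, v} \<in> E" "\<forall>u\<in>B. \<forall>v\<in>B. {u, v} \<notin> E"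
    using assms(2) unfolding split_graph_def by (elim exE conjE)
  then have clique: "\<And>u v. u \<in> A \<Longrightarrow> v \<in> A \<Longrightarrow> u \<noteq> v \<Longrightarrow> {u, v} \<in> E"
    and indep: "\<And>u v. u \<in> B \<Longrightarrow> v \<in> B \<Longrightarrow> {u, v} \<notin> E" by auto
  have fin: "finite A" "finite B" using AB by (metis finite_Un finite_atLeastLessThan)+
  define a b where "a = card A" and "b = card B"
  have n: "n = a + b" using AB card_Un_disjoint[OF fin AB(2)] by (simp add: a_def b_def)
  obtain f where f: "bij_betw f {..<a} A"
    using ex_bij_betw_nat_finite[OF fin(1)] by (auto simp: a_def lessThan_atLeast0)
  obtain g where g: "bij_betw g {..<b} B"
    using ex_bij_betw_nat_finite[OF fin(2)] by (auto simp: b_def lessThan_atLeast0)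
  \<comment> \<open>The enumeration lists the clique \<open>A\<close> first and then
    \<open>B\<close>, which turns the Laplacian into \<open>Lmat\<close>.\<close>
  define \<pi> where "\<pi> i = (if i < a then f i else g (i - a))" for i
  have fA: "f i \<in> A" if "i < a" for i using f that by (auto simp: bij_betw_def)
  have gB: "g j \<in> B" if "j < b" for j using g that by (auto simp: bij_betw_def)
  have f_inj: "f i = f p \<longleftrightarrow> i = p" if "i < a" "p < a" for i p
    using f that by (auto simp: bij_betw_def inj_on_def)
  have g_inj: "g i = g p \<longleftrightarrow> i = p" if "i < b" "p < b" for i p
    using g that by (auto simp: bij_betw_def inj_on_def)
  have fg: "f i \<noteq> g j" if "i < a" "j < b" for i j
    using fA[OF that(1)] gB[OF that(2)] AB(2) by (metis disjoint_iff)
  have fn: "f i < n" if "i < a" for i using fA[OF that] AB by auto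
  have gn: "g j < n" if "j < b" for j using gB[OF that] AB by auto
  have sum_n: "(\<Sum>v<n. h v) = (\<Sum>i<a. h (f i)) + (\<Sum>j<b. h (g j))" for h :: "nat \<Rightarrow> real"
  proof -
    have "(\<Sum>v<n. h v) = (\<Sum>v\<in>A. h v) + (\<Sum>v\<in>B. h v)"
      using AB fin by (subst sum.union_disjoint[symmetric]) (auto simp: lessThan_atLeast0)
    then show ?thesis using sum.reindex_bij_betw[OF f, of h] sum.reindex_bij_betw[OF g, of h] by simp
  qed
  have bij: "bij_betw \<pi> {..<n} {..<n}"
    unfolding bij_betw_def
  proof
    show inj: "inj_on \<pi> {..<n}"
    proof (rule inj_onI)
      fix x y assume "x \<in> {..<n}" "y \<in> {..<n}" "\<pi> x = \<pi> y"
      moreover have "x - a < b" if "\<not> x < a" using calculation(1) that n by auto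
      moreover have "y - a < b" if "\<not> y < a" using calculation(2) that n by auto
      ultimately show "x = y"
        using f_inj[of x y] g_inj[of "x - a" "y - a"] fg[of x "y - a"] fg[of y "x - a"]
        by (cases "x < a"; cases "y < a") (auto simp: \<pi>_def)
    qed
    have "\<pi> ` {..<n} \<subseteq> {..<n}" using fn gn by (auto simp: \<pi>_def n)
    then show "\<pi> ` {..<n} = {..<n}" using inj by (simp add: endo_inj_surj)
  qed
  define N where "N i j = adj E (f i) (g j)" for i j
  interpret bipartite_weights a b N
    by unfold_locales (auto simp: N_def adj_nonneg adj_le_1)
  have degA: "real (degree E (f i)) = rsum i + a - 1" if i: "i < a" for i
  proof -
    have "(\<Sum>p<a. adj E (f i) (f p)) = (\<Sum>p<a. 1 - of_bool (p = i))"
      using i clique[OF fA fA] f_inj by (intro sum.cong refl) (auto simp: adj_def)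
    also have "\<dots> = real a - 1" using i by (simp add: sum_subtractf of_bool_def)
    finally show ?thesis
      using degree_eq_sum_adj[OF E fn[OF i]] by (simp add: sum_n rsum_def N_def)
  qed
  have degB: "real (degree E (g j)) = csum j" if j: "j < b" for j
  proof -
    have "(\<Sum>l<b. adj E (g j) (g l)) = 0"
      using j indep[OF gB gB] by (intro sum.neutral) (auto simp: adj_def)
    then show ?thesis
      using degree_eq_sum_adj[OF E gn[OF j]] by (simp add: sum_n csum_def N_def adj_commute)
  qed
  have "mat n n (\<lambda>(i, j). laplacian n E $$ (\<pi> i, \<pi> j)) = Lmat"
  proof (rule eq_matI)
    fix i j assume "i < dim_row Lmat" "j < dim_col Lmat"
    then have ij: "i < a + b" "j < a + b" using carriers(1) by auto
    consider "i < a" "j < a" | "i < a" "a \<le> j" "j - a < b" | "a \<le> i" "i - a < b" "j < a"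
      | "a \<le> i" "i - a < b" "a \<le> j" "j - a < b"
      using ij by linarith
    then show "mat n n (\<lambda>(i, j). laplacian n E $$ (\<pi> i, \<pi> j)) $$ (i, j) = Lmat $$ (i, j)"
    proof cases
      case 1
      then show ?thesis using ij fn degA clique[OF fA fA] f_inj
        by (auto simp: Lmat_def \<pi>_def laplacian_def n[symmetric])
    next
      case 2
      then show ?thesis using ij fn gn fg[of i "j - a"]
        by (auto simp: Lmat_def \<pi>_def laplacian_def n[symmetric] N_def adj_def)
    next
      case 3
      then show ?thesis using ij fn gn fg[of j "i - a"]
        by (auto simp: Lmat_def \<pi>_def laplacian_def n[symmetric] N_def adj_def insert_commute)
    next
      case 4
      then show ?thesis using ij gn degB indep[OF gB gB] g_inj[of "i - a" "j - a"]
        by (auto simp: Lmat_def \<pi>_def laplacian_def n[symmetric])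
    qed
  qed (use carriers(1) n in auto)
  then have "char_poly Lmat = lin_prod (lap_eigs n E)"
    using char_poly_reindex[OF laplacian_carrier bij] lap_eigs(3) by metis
  then have excess: "sum_list (map (\<lambda>l. max 0 (l - a)) (lap_eigs n E)) \<le> (\<Sum>i<a. rsum i)"
    by (rule sum_excess_le)
  have "2 * real (card E) = (\<Sum>i<a. rsum i + a - 1) + (\<Sum>j<b. csum j)"
    using sum_degrees[OF E] degA degB by (simp add: sum_n)
  also have "(\<Sum>j<b. csum j) = (\<Sum>i<a. rsum i)"
    unfolding rsum_def csum_def by (rule sum.swap)
  finally have edges: "2 * real (card E) = 2 * (\<Sum>i<a. rsum i) + a * (real a - 1)"
    by (simp add: sum.distrib sum_subtractf algebra_simps)
  have two_tri_k: "2 * real (tri k) = k * (real k + 1)"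
    using arg_cong[OF two_tri[of k], of real] by (simp add: algebra_simps)
  \<comment> \<open>A product of consecutive integers; it is twice the difference of the two sides
    of the next inequality.\<close>
  have "0 \<le> (real a - k) * (real a - k - 1)"
    by (cases "a \<le> k") (auto intro: mult_nonpos_nonpos mult_nonneg_nonneg)
  then have "k * a + (\<Sum>i<a. rsum i) \<le> card E + tri k"
    using edges two_tri_k by (simp add: algebra_simps)
  moreover have "lap_eig_sum n E k \<le> k * a + (\<Sum>i<a. rsum i)"
    unfolding lap_eig_sum_def using sum_take_le[of "real a" k "lap_eigs n E"] excess by simp
  ultimately show ?thesis by simp
qed

theorem theorem2:
  fixes n :: nat and E :: "nat set set"
  assumes "simple_graph {0..<n} E"
    and "split_graph {0..<n} E"
  shows "spectrally_threshold_dominated n E"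
  using assms by (intro spectrally_threshold_dominatedI split_graph_eig_sum_le)

end
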